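(* Consider the planted submatrix problem with target $x=v_1$, and define $\kappa_\alpha$ as below. (i) If $0<r<1$, $\lambda\le\sqrt{\frac{r}{e\rho^2n}}$ and the integer $D\ge1$ satisfies $D\le\min\{\log_2(1/\rho)-1,\ \sqrt{\tfrac e3r\rho^2n}\}$, then $\mathrm{Corr}_{\le D}^2\le2\rho^2/(1-r)^2$. (ii) If the integer $D$ satisfies $1\le D\le\min\{\log_2(1/\rho)-1,\ n-1\}$, then \[ \sum_{\alpha\in\mathbb{N}^N,\ 0\le|\alpha|\le D}\frac{\kappa_\alpha^2}{\alpha!}\ge\frac{\rho^2}{4eD^{3/2}}\big[e\lambda^2\rho^2(n-D)\big]^D. \]
   Context: Planted submatrix problem: observe $Y=\lambda vv^\top+W$ ($n\times n$), $v\in\{0,1\}^n$ i.i.d. $\mathrm{Bernoulli}(\rho)$, $\rho\in(0,1)$, $\lambda\ge0$, $W$ symmetric with $W_{ij}=W_{ji}\sim\mathcal{N}(0,1)$ for $i<j$, $W_{ii}\sim\mathcal{N}(0,2)$, $\{W_{ij}:i\le j\}$ independent and independent of $v$. $\mathrm{Corr}_{\le D}=\sup\{\mathbb{E}[f(Y)x]/\sqrt{\mathbb{E}f(Y)^2}\}$ over real polynomials $f$ of degree $\le D$ in the entries of $Y$ with $\mathbb{E}f(Y)^2\ne0$. For $\kappa_\alpha$: $N=n(n+1)/2$ indexed by pairs $(i,j)$, $i\le j$; $X_{ij}=\lambda v_iv_j$; $\alpha\in\mathbb{N}^N$ with $|\alpha|=\sum\alpha_{ij}$, $\alpha!=\prod\alpha_{ij}!$,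 $X^\alpha=\prod X_{ij}^{\alpha_{ij}}$, $\binom\alpha\beta=\prod\binom{\alpha_{ij}}{\beta_{ij}}$, $\beta\le\alpha$ entrywise, $\beta\lneq\alpha$ meaning $\beta\le\alpha,\beta\ne\alpha$; $\kappa_\alpha=\mathbb{E}[v_1X^\alpha]-\sum_{0\le\beta\lneq\alpha}\kappa_\beta\binom\alpha\beta\mathbb{E}[X^{\alpha-\beta}]$. *)

theory Defs
  imports "HOL-Probability.Probability" "HOL-Probability.Product_PMF"
begin

text \<open>Planted submatrix model. Indices are 0-based: rows/columns 0..n-1, target x = v 0.
  Upper-triangular index pairs (i,j), i \<le> j < n, index the N = n(n+1)/2 observed entries.\<close>

definition Idx :: "nat \<Rightarrow> (nat \<times> nat) set" where
  "Idx n = {(i, j). i \<le> j \<and> j < n}"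

definition Vdist :: "nat \<Rightarrow> real \<Rightarrow> (nat \<Rightarrow> bool) pmf" where
  "Vdist n rho = Pi_pmf {..<n} False (\<lambda>_. bernoulli_pmf rho)"

text \<open>Law of the noise W (upper triangle incl. diagonal): independent N(0,1) off-diagonal,
  N(0,2) on the diagonal (normal_density mu sigma uses the standard deviation sigma).\<close>
definition Wdist :: "nat \<Rightarrow> (nat \<times> nat \<Rightarrow> real) measure" where
  "Wdist n = PiM (Idx n) (\<lambda>p. if fst p = snd p
                                 then density lborel (normal_density 0 (sqrt 2))
                                 else density lborel (normal_density 0 1))"

definition Joint :: "nat \<Rightarrow> real \<Rightarrow> ((nat \<Rightarrow> bool) \<times> (nat \<times> nat \<Rightarrow> real)) measure" where
  "Joint n rho = measure_pmf (Vdist n rho) \<Otimes>\<^sub>M Wdist n"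

definition Ymat :: "real \<Rightarrow> (nat \<Rightarrow> bool) \<Rightarrow> (nat \<times> nat \<Rightarrow> real) \<Rightarrow> nat \<times> nat \<Rightarrow> real" where
  "Ymat lam v W p = lam * of_bool (v (fst p) \<and> v (snd p)) + W p"

definition Mons :: "nat \<Rightarrow> nat \<Rightarrow> (nat \<times> nat \<Rightarrow> nat) set" where
  "Mons n D = {\<alpha>. (\<forall>p. p \<notin> Idx n \<longrightarrow> \<alpha> p = 0) \<and> (\<Sum>p\<in>Idx n. \<alpha> p) \<le> D}"

definition polyval :: "nat \<Rightarrow> nat \<Rightarrow> ((nat \<times> nat \<Rightarrow> nat) \<Rightarrow> real) \<Rightarrow> (nat \<times> nat \<Rightarrow> real) \<Rightarrow> real" where
  "polyval n D c Y = (\<Sum>\<alpha>\<in>Mons n D. c \<alpha> * (\<Prod>p\<in>Idx n. Y p ^ \<alpha> p))"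

definition Corr :: "nat \<Rightarrow> real \<Rightarrow> real \<Rightarrow> nat \<Rightarrow> real" where
  "Corr n rho lam D =
     Sup ((\<lambda>c. (\<integral>\<omega>. polyval n D c (Ymat lam (fst \<omega>) (snd \<omega>)) * of_bool (fst \<omega> 0) \<partial>Joint n rho)
               / sqrt (\<integral>\<omega>. (polyval n D c (Ymat lam (fst \<omega>) (snd \<omega>)))\<^sup>2 \<partial>Joint n rho))
          ` {c. (\<integral>\<omega>. (polyval n D c (Ymat lam (fst \<omega>) (snd \<omega>)))\<^sup>2 \<partial>Joint n rho) \<noteq> 0})"

definition Xmon :: "nat \<Rightarrow> real \<Rightarrow> (nat \<Rightarrow> bool) \<Rightarrow> (nat \<times> nat \<Rightarrow> nat) \<Rightarrow> real" where
  "Xmon n lam v \<alpha> = (\<Prod>p\<in>Idx n. (lam * of_bool (v (fst p) \<and> v (snd p))) ^ \<alpha> p)"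

definition EXmon :: "nat \<Rightarrow> real \<Rightarrow> real \<Rightarrow> (nat \<times> nat \<Rightarrow> nat) \<Rightarrow> real" where
  "EXmon n rho lam \<alpha> = measure_pmf.expectation (Vdist n rho) (\<lambda>v. Xmon n lam v \<alpha>)"

definition Ev1Xmon :: "nat \<Rightarrow> real \<Rightarrow> real \<Rightarrow> (nat \<times> nat \<Rightarrow> nat) \<Rightarrow> real" where
  "Ev1Xmon n rho lam \<alpha> = measure_pmf.expectation (Vdist n rho) (\<lambda>v. of_bool (v 0) * Xmon n lam v \<alpha>)"

definition mbinom :: "nat \<Rightarrow> (nat \<times> nat \<Rightarrow> nat) \<Rightarrow> (nat \<times> nat \<Rightarrow> nat) \<Rightarrow> real" where
  "mbinom n \<alpha> \<beta> = (\<Prod>p\<in>Idx n. real (\<alpha> p choose \<beta> p))"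

definition mfact :: "nat \<Rightarrow> (nat \<times> nat \<Rightarrow> nat) \<Rightarrow> real" where
  "mfact n \<alpha> = (\<Prod>p\<in>Idx n. fact (\<alpha> p))"

text \<open>The recursion for kappa, unrolled with an explicit depth k; kappa alpha uses depth |alpha|,
  which suffices since every beta strictly below alpha has |beta| < |alpha|.\<close>
fun kap_aux :: "nat \<Rightarrow> nat \<Rightarrow> real \<Rightarrow> real \<Rightarrow> (nat \<times> nat \<Rightarrow> nat) \<Rightarrow> real" where
  "kap_aux 0 n rho lam \<alpha> = Ev1Xmon n rho lam \<alpha>"
| "kap_aux (Suc k) n rho lam \<alpha> = Ev1Xmon n rho lam \<alpha>
     - (\<Sum>\<beta>\<in>{\<beta>. (\<forall>p. \<beta> p \<le> \<alpha> p) \<and> \<beta> \<noteq> \<alpha>}.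
          kap_aux k n rho lam \<beta> * mbinom n \<alpha> \<beta> * EXmon n rho lam (\<lambda>p. \<alpha> p - \<beta> p))"

definition kappa :: "nat \<Rightarrow> real \<Rightarrow> real \<Rightarrow> (nat \<times> nat \<Rightarrow> nat) \<Rightarrow> real" where
  "kappa n rho lam \<alpha> = kap_aux (\<Sum>p\<in>Idx n. \<alpha> p) n rho lam \<alpha>"

end

theory Submission
  imports Defs
begin

text \<open>
  Read \<open>\<alpha>\<close> as a multigraph on the vertices, with vertex 0 the target. If some component of \<open>\<alpha>\<close>
  avoids vertex 0, then independence forces \<open>\<kappa>\<^sub>\<alpha> = 0\<close>. Otherwise every proper splitting
  \<open>\<alpha> = \<beta> + \<gamma>\<close> shares a vertex and hence costs an extra factor \<open>\<rho>\<close>; as there are only \<open>2 ^ |\<alpha>|\<close>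
  splittings and \<open>2 ^ D \<rho> \<le> 1/2\<close>, the recursion gives
  \<open>t / 2 \<le> \<kappa>\<^sub>\<alpha> \<le> t\<close> with \<open>t = \<lambda> ^ |\<alpha>| * \<rho> ^ |V(\<alpha>) \<union> {0}|\<close>.

  For (i), a connected \<open>\<alpha>\<close> on \<open>m + 1\<close> vertices is a spanning tree, given by one of at most
  \<open>(m + 1) ^ m\<close> parent functions, plus excess edges; summing over the number of vertices and of excess
  edges gives two geometric series. For (ii), only the trees with exactly \<open>D\<close> edges are kept, and
  Cayley's formula counts them. Finally \<open>Corr\<^sup>2 \<le> \<Sum> \<kappa>\<^sub>\<alpha>\<^sup>2 / \<alpha>!\<close> because the
  Hermite series \<open>\<Sum> \<kappa>\<^sub>\<alpha> / \<alpha>! * He\<^sub>\<alpha>(W)\<close> has the same inner product with each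
  polynomial of degree at most \<open>D\<close> in \<open>Y\<close> as the target, so that Cauchy-Schwarz applies.
\<close>

section \<open>The recursion for kappa\<close>

text \<open>What ties \<open>kappa\<close> to the correlation is a triangular linear system. For a
  Gaussian of variance s, the mean of He_a(W) He_b(W + x) is s^a a! binom(b, a) x^(b - a).
  Multiplied over the entries and averaged over v, this makes the pairing of He_\<alpha>(W) with
  He_\<beta>(Y) a constant depending only on \<alpha> times the coefficient of \<open>kappa\<close>
  at \<alpha> in the recursion at \<beta>. The recursion is forward substitution in that system, so
  the dual witness can be written down although the He_\<beta>(Y) are not orthogonal.

  The obstacle is that the recursion is signed, so sizes can only be read off once its leading term
  dominates; D \<le> log_2(1/rho) - 1 says exactly that 2^D rho \<le> 1/2. The factor 1/2 lost there
  becomes, squared, the 4 in (ii). The remaining e D^(3/2) comes from a Stirling bound in which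
  e^(D-1) appears instead of e^D. In (i) the constant 2 absorbs the sum 3/2 of the geometric series
  over excess edges.\<close>

declare split_paired_All [simp del] split_paired_Ex [simp del]

section \<open>Multi-indices: degree, touched vertices, down-sets\<close>

definition msupp :: "nat \<Rightarrow> (nat \<times> nat \<Rightarrow> nat) set" where
  "msupp n = {\<alpha>. \<forall>p. p \<notin> Idx n \<longrightarrow> \<alpha> p = 0}"

definition mdeg :: "nat \<Rightarrow> (nat \<times> nat \<Rightarrow> nat) \<Rightarrow> nat" where
  "mdeg n \<alpha> = (\<Sum>p\<in>Idx n. \<alpha> p)"

definition verts :: "(nat \<times> nat \<Rightarrow> nat) \<Rightarrow> nat set" where
  "verts \<alpha> = (\<Union>p\<in>{p. \<alpha> p \<noteq> 0}. {fst p, snd p})"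

definition below :: "(nat \<times> nat \<Rightarrow> nat) \<Rightarrow> (nat \<times> nat \<Rightarrow> nat) set" where
  "below \<alpha> = {\<beta>. \<forall>p. \<beta> p \<le> \<alpha> p}"

lemma belowD: "\<beta> \<in> below \<alpha> \<Longrightarrow> \<beta> p \<le> \<alpha> p"
  by (simp add: below_def)

lemma finite_Idx [simp]: "finite (Idx n)"
  by (rule finite_subset[of _ "{..<n} \<times> {..<n}"]) (auto simp: Idx_def)

lemma mfact_ge_1: "1 \<le> mfact n \<alpha>"
  unfolding mfact_def by (intro prod_ge_1) simp

lemma mfact_pos: "0 < mfact n \<alpha>"
  using mfact_ge_1[of n \<alpha>] by linarith

lemma Mons_eq: "Mons n D = {\<alpha> \<in> msupp n. mdeg n \<alpha> \<le> D}"
  by (auto simp: Mons_def msupp_def mdeg_def)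

text \<open>A down-set is a box, namely a product of intervals with default value 0 off
  \<open>Idx n\<close>. Sums over it therefore factor entry by entry.\<close>

lemma below_eq_PiE_dflt:
  assumes "\<alpha> \<in> msupp n"
  shows "below \<alpha> = PiE_dflt (Idx n) 0 (\<lambda>p. {..\<alpha> p})"
proof (rule set_eqI)
  fix \<beta>
  show "\<beta> \<in> below \<alpha> \<longleftrightarrow> \<beta> \<in> PiE_dflt (Idx n) 0 (\<lambda>p. {..\<alpha> p})"
    using assms unfolding below_def PiE_dflt_def msupp_def by (simp, metis le_zero_eq)
qed

lemma finite_below: "\<alpha> \<in> msupp n \<Longrightarrow> finite (below \<alpha>)"
  by (simp add: below_eq_PiE_dflt finite_PiE_dflt)

lemma finite_Mons [simp]: "finite (Mons n D)"
proof (rule finite_subset)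
  show "Mons n D \<subseteq> PiE_dflt (Idx n) 0 (\<lambda>p. {..D})"
  proof
    fix \<alpha> assume \<alpha>: "\<alpha> \<in> Mons n D"
    have "\<alpha> p \<le> D" if "p \<in> Idx n" for p
      using \<alpha> member_le_sum[of p "Idx n" \<alpha>] that by (auto simp: Mons_def)
    then show "\<alpha> \<in> PiE_dflt (Idx n) 0 (\<lambda>p. {..D})"
      using \<alpha> by (auto simp: PiE_dflt_def Mons_def)
  qed
qed (simp add: finite_PiE_dflt)

lemma below_msupp: "\<alpha> \<in> msupp n \<Longrightarrow> \<beta> \<in> below \<alpha> \<Longrightarrow> \<beta> \<in> msupp n"
  unfolding msupp_def below_def by (simp, metis le_zero_eq)

lemma diff_msupp: "\<alpha> \<in> msupp n \<Longrightarrow> (\<lambda>p. \<alpha> p - \<beta> p) \<in> msupp n"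
  by (auto simp: msupp_def)

lemma mdeg_below_diff: "\<beta> \<in> below \<alpha> \<Longrightarrow> mdeg n \<beta> + mdeg n (\<lambda>p. \<alpha> p - \<beta> p) = mdeg n \<alpha>"
  by (simp add: mdeg_def below_def flip: sum.distrib)

lemma mdeg_below_less:
  assumes "\<alpha> \<in> msupp n" "\<beta> \<in> below \<alpha>" "\<beta> \<noteq> \<alpha>"
  shows "mdeg n \<beta> < mdeg n \<alpha>"
  unfolding mdeg_def
proof (rule sum_strict_mono_ex1)
  obtain p where p: "\<beta> p \<noteq> \<alpha> p" using assms(3) by blast
  moreover have "\<beta> p \<le> \<alpha> p" using assms(2) by (simp add: below_def)
  ultimately have "\<beta> p < \<alpha> p" by simp
  moreover have "p \<in> Idx n" using assms(1) calculation by (auto simp: msupp_def)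
  ultimately show "\<exists>p\<in>Idx n. \<beta> p < \<alpha> p" by blast
qed (use assms(2) in \<open>auto simp: below_def\<close>)

lemma ball_verts: "(\<forall>i\<in>verts \<alpha>. P i) \<longleftrightarrow> (\<forall>p. \<alpha> p \<noteq> 0 \<longrightarrow> P (fst p) \<and> P (snd p))"
  by (simp add: verts_def)

lemma fst_in_verts: "\<alpha> p \<noteq> 0 \<Longrightarrow> fst p \<in> verts \<alpha>"
  and snd_in_verts: "\<alpha> p \<noteq> 0 \<Longrightarrow> snd p \<in> verts \<alpha>"
  unfolding verts_def by blast+

lemma below_subset_Mons:
  assumes "\<beta> \<in> Mons n D"
  shows "below \<beta> \<subseteq> Mons n D"
proof
  fix \<alpha> assume "\<alpha> \<in> below \<beta>"
  then show "\<alpha> \<in> Mons n D"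
    using below_msupp[of \<beta> n \<alpha>] mdeg_below_diff[of \<alpha> \<beta> n] assms by (auto simp: Mons_eq)
qed

lemma verts_subset: "\<alpha> \<in> msupp n \<Longrightarrow> verts \<alpha> \<subseteq> {..<n}"
proof
  fix i assume \<alpha>: "\<alpha> \<in> msupp n" and i: "i \<in> verts \<alpha>"
  from i obtain p where p: "\<alpha> p \<noteq> 0" "i = fst p \<or> i = snd p" by (auto simp: verts_def)
  have "p \<in> Idx n" using \<alpha> p(1) by (auto simp: msupp_def)
  then show "i \<in> {..<n}" using p(2) by (auto simp: Idx_def)
qed

lemma finite_verts [simp]: "\<alpha> \<in> msupp n \<Longrightarrow> finite (verts \<alpha>)"
  using verts_subset finite_subset by blast

text \<open>The entries of the signal are 0 or \<open>lam\<close>, so positive powers of the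
  indicators collapse: multiplicities enter only through the degree, and the rest is the event that
  all touched vertices are selected.\<close>

lemma Xmon_eq:
  assumes "\<alpha> \<in> msupp n"
  shows "Xmon n lam v \<alpha> = lam ^ mdeg n \<alpha> * of_bool (\<forall>i\<in>verts \<alpha>. v i)"
proof -
  have "Xmon n lam v \<alpha> = (\<Prod>p\<in>Idx n. lam ^ \<alpha> p * of_bool (\<alpha> p = 0 \<or> v (fst p) \<and> v (snd p)))"
    unfolding Xmon_def by (intro prod.cong refl) (auto simp: power_mult_distrib)
  also have "\<dots> = lam ^ mdeg n \<alpha> * (\<Prod>p\<in>Idx n. of_bool (\<alpha> p = 0 \<or> v (fst p) \<and> v (snd p)))"
    by (simp add: prod.distrib mdeg_def power_sum)
  also have "(\<Prod>p\<in>Idx n. of_bool (\<alpha> p = 0 \<or> v (fst p) \<and> v (snd p))) =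
     (of_bool (\<forall>p\<in>Idx n. \<alpha> p = 0 \<or> v (fst p) \<and> v (snd p)) :: real)"
    by (cases "\<forall>p\<in>Idx n. \<alpha> p = 0 \<or> v (fst p) \<and> v (snd p)") (auto simp: prod_zero_iff)
  also have "(\<forall>p\<in>Idx n. \<alpha> p = 0 \<or> v (fst p) \<and> v (snd p)) \<longleftrightarrow> (\<forall>i\<in>verts \<alpha>. v i)"
    using assms unfolding ball_verts msupp_def mem_Collect_eq by metis
  finally show ?thesis .
qed

lemma finite_set_pmf_Vdist [simp]: "finite (set_pmf (Vdist n rho))"
  unfolding Vdist_def
  by (rule finite_subset[OF set_Pi_pmf_subset']) (auto intro!: finite_PiE_dflt)

text \<open>The indicator is written as a product over all n coordinates, with factor 1 outside S,
  so that independence under \<open>Pi_pmf\<close> applies directly.\<close>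

lemma expectation_all_selected:
  assumes "S \<subseteq> {..<n}" "0 \<le> rho" "rho \<le> 1"
  shows "measure_pmf.expectation (Vdist n rho) (\<lambda>v. of_bool (\<forall>i\<in>S. v i)) = rho ^ card S"
proof -
  have "(\<lambda>v. of_bool (\<forall>i\<in>S. v i) :: real) = (\<lambda>v. \<Prod>i\<in>{..<n}. of_bool (i \<in> S \<longrightarrow> v i))"
  proof
    fix v :: "nat \<Rightarrow> bool"
    show "of_bool (\<forall>i\<in>S. v i) = (\<Prod>i\<in>{..<n}. of_bool (i \<in> S \<longrightarrow> v i) :: real)"
      using assms(1) by (cases "\<forall>i\<in>S. v i") (auto simp: prod_zero_iff)
  qed
  then have "measure_pmf.expectation (Vdist n rho) (\<lambda>v. of_bool (\<forall>i\<in>S. v i) :: real) =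
    measure_pmf.expectation (Vdist n rho) (\<lambda>v. \<Prod>i\<in>{..<n}. of_bool (i \<in> S \<longrightarrow> v i))"
    by (simp only:)
  also have "\<dots> = (\<Prod>i\<in>{..<n}. measure_pmf.expectation (bernoulli_pmf rho) (\<lambda>b. of_bool (i \<in> S \<longrightarrow> b)))"
    unfolding Vdist_def
    by (rule expectation_prod_Pi_pmf) (auto intro!: integrable_measure_pmf_finite)
  also have "\<dots> = (\<Prod>i\<in>{..<n}. if i \<in> S then rho else 1)"
    using assms(2,3) by (intro prod.cong refl) auto
  also have "\<dots> = rho ^ card S"
    using assms(1) by (simp add: prod.If_cases Int_absorb1)
  finally show ?thesis .
qed

lemma EXmon_eq:
  assumes "\<alpha> \<in> msupp n" "0 \<le> rho" "rho \<le> 1"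
  shows "EXmon n rho lam \<alpha> = lam ^ mdeg n \<alpha> * rho ^ card (verts \<alpha>)"
  unfolding EXmon_def
  using assms by (simp add: Xmon_eq expectation_all_selected verts_subset)

lemma Ev1Xmon_eq:
  assumes "\<alpha> \<in> msupp n" "0 < n" "0 \<le> rho" "rho \<le> 1"
  shows "Ev1Xmon n rho lam \<alpha> = lam ^ mdeg n \<alpha> * rho ^ card (insert 0 (verts \<alpha>))"
proof -
  have "Ev1Xmon n rho lam \<alpha> =
    measure_pmf.expectation (Vdist n rho) (\<lambda>v. lam ^ mdeg n \<alpha> * of_bool (\<forall>i\<in>insert 0 (verts \<alpha>). v i))"
    unfolding Ev1Xmon_def using assms(1) by (intro Bochner_Integration.integral_cong) (auto simp: Xmon_eq)
  also have "\<dots> = lam ^ mdeg n \<alpha> * measure_pmf.expectation (Vdist n rho) (\<lambda>v. of_bool (\<forall>i\<in>insert 0 (verts \<alpha>). v i))"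
    by (rule integral_mult_right_zero)
  also have "\<dots> = lam ^ mdeg n \<alpha> * rho ^ card (insert 0 (verts \<alpha>))"
    using verts_subset[OF assms(1)] assms(2-) by (subst expectation_all_selected) auto
  finally show ?thesis .
qed

text \<open>The depth argument is only fuel. Each unfolding strictly lowers the degree, and in
  degree 0 there is no proper \<beta>, so the base clause and the recursive clause agree
  there.\<close>

lemma kap_aux_depth:
  assumes "\<alpha> \<in> msupp n" "mdeg n \<alpha> \<le> k" "mdeg n \<alpha> \<le> k'"
  shows "kap_aux k n rho lam \<alpha> = kap_aux k' n rho lam \<alpha>"
  using assms
proof (induction k arbitrary: k' \<alpha>)
  case 0
  then have "\<beta> = \<alpha>" if "\<forall>p. \<beta> p \<le> \<alpha> p" for \<beta>
    using mdeg_below_less[of \<alpha> n \<beta>] that by (auto simp: below_def)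
  then have "{\<beta>. (\<forall>p. \<beta> p \<le> \<alpha> p) \<and> \<beta> \<noteq> \<alpha>} = {}" by blast
  then show ?case by (cases k') (simp_all only: kap_aux.simps sum.empty diff_0_right)
next
  case (Suc k)
  show ?case
  proof (cases k')
    case 0
    then have "\<beta> = \<alpha>" if "\<forall>p. \<beta> p \<le> \<alpha> p" for \<beta>
      using Suc.prems mdeg_below_less[of \<alpha> n \<beta>] that by (auto simp: below_def)
    then have "{\<beta>. (\<forall>p. \<beta> p \<le> \<alpha> p) \<and> \<beta> \<noteq> \<alpha>} = {}" by blast
    then show ?thesis using 0 by (simp only: kap_aux.simps sum.empty diff_0_right)
  next
    case k': (Suc k'')
    have "kap_aux k n rho lam \<beta> = kap_aux k'' n rho lam \<beta>"
      if "\<beta> \<in> {\<beta>. (\<forall>p. \<beta> p \<le> \<alpha> p) \<and> \<beta> \<noteq> \<alpha>}" for \<beta>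
    proof (rule Suc.IH)
      have \<beta>: "\<beta> \<in> below \<alpha>" "\<beta> \<noteq> \<alpha>" using that by (auto simp: below_def)
      show "\<beta> \<in> msupp n" using below_msupp Suc.prems(1) \<beta>(1) .
      show "mdeg n \<beta> \<le> k" "mdeg n \<beta> \<le> k''"
        using mdeg_below_less[OF Suc.prems(1) \<beta>] Suc.prems k' by auto
    qed
    then show ?thesis unfolding k' kap_aux.simps by (intro arg_cong2[of _ _ _ _ minus] sum.cong) auto
  qed
qed

lemma EXmon_zero: "EXmon n rho lam (\<lambda>p. 0) = 1"
  by (simp add: EXmon_def Xmon_def)

lemma kappa_rec:
  assumes "\<alpha> \<in> msupp n"
  shows "kappa n rho lam \<alpha> = Ev1Xmon n rho lam \<alpha> -
    (\<Sum>\<beta>\<in>below \<alpha> - {\<alpha>}. kappa n rho lam \<beta> * mbinom n \<alpha> \<beta> * EXmon n rho lam (\<lambda>p. \<alpha> p - \<beta> p))"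
proof -
  have set_eq: "below \<alpha> - {\<alpha>} = {\<beta>. (\<forall>p. \<beta> p \<le> \<alpha> p) \<and> \<beta> \<noteq> \<alpha>}" by (auto simp: below_def)
  have "kappa n rho lam \<alpha> = kap_aux (Suc (mdeg n \<alpha>)) n rho lam \<alpha>"
    unfolding kappa_def mdeg_def[symmetric] using assms by (intro kap_aux_depth) auto
  also have "\<dots> = Ev1Xmon n rho lam \<alpha> -
    (\<Sum>\<beta>\<in>below \<alpha> - {\<alpha>}. kappa n rho lam \<beta> * mbinom n \<alpha> \<beta> * EXmon n rho lam (\<lambda>p. \<alpha> p - \<beta> p))"
    unfolding kap_aux.simps set_eq[symmetric]
  proof (intro arg_cong2[of _ _ _ _ minus] sum.cong refl)
    fix \<beta> assume \<beta>: "\<beta> \<in> below \<alpha> - {\<alpha>}"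
    have "kap_aux (mdeg n \<alpha>) n rho lam \<beta> = kappa n rho lam \<beta>"
      unfolding kappa_def mdeg_def[symmetric]
      using \<beta> assms mdeg_below_less[OF assms, of \<beta>]
      by (intro kap_aux_depth) (auto intro: below_msupp)
    then show "kap_aux (mdeg n \<alpha>) n rho lam \<beta> * mbinom n \<alpha> \<beta> * EXmon n rho lam (\<lambda>p. \<alpha> p - \<beta> p) =
      kappa n rho lam \<beta> * mbinom n \<alpha> \<beta> * EXmon n rho lam (\<lambda>p. \<alpha> p - \<beta> p)"
      by simp
  qed
  finally show ?thesis .
qed

text \<open>Moving the sum to the left supplies the missing summand \<beta> = \<alpha>, whose
  binomial and moment are both 1. In this convolution form the recursion serves the vanishing on
  detached multigraphs as well as the dual witness.\<close>

lemma sum_kappa_below: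
  assumes "\<alpha> \<in> msupp n"
  shows "(\<Sum>\<beta>\<in>below \<alpha>. kappa n rho lam \<beta> * mbinom n \<alpha> \<beta> * EXmon n rho lam (\<lambda>p. \<alpha> p - \<beta> p))
    = Ev1Xmon n rho lam \<alpha>"
proof -
  have "mbinom n \<alpha> \<alpha> = 1" by (simp add: mbinom_def)
  moreover have "\<alpha> \<in> below \<alpha>" by (simp add: below_def)
  ultimately show ?thesis
    using kappa_rec[OF assms, of rho lam] finite_below[OF assms]
    by (simp add: sum.remove[of "below \<alpha>" \<alpha>] EXmon_zero)
qed

text \<open>Distributivity for total functions with a default value, which is how multi-indices are
  represented; it differs from the \<open>PiE\<close> version only in the value taken off A.\<close>

lemma prod_sum_PiE_dflt:
  fixes f :: "'a \<Rightarrow> 'b \<Rightarrow> 'c :: comm_semiring_1"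
  assumes "finite A" "\<And>x. x \<in> A \<Longrightarrow> finite (B x)"
  shows "(\<Prod>x\<in>A. \<Sum>y\<in>B x. f x y) = (\<Sum>h\<in>PiE_dflt A d B. \<Prod>x\<in>A. f x (h x))"
proof -
  have "(\<Sum>h\<in>PiE_dflt A d B. \<Prod>x\<in>A. f x (h x)) = (\<Sum>h\<in>PiE A B. \<Prod>x\<in>A. f x (h x))"
  proof (rule sum.reindex_bij_witness[of _ "\<lambda>h x. if x \<in> A then h x else d" "\<lambda>h. restrict h A"])
  qed (auto simp: PiE_dflt_def fun_eq_iff PiE_def extensional_def)
  then show ?thesis using assms by (simp add: prod_sum_PiE)
qed

lemma sum_mbinom_below:
  assumes "\<alpha> \<in> msupp n"
  shows "(\<Sum>\<beta>\<in>below \<alpha>. mbinom n \<alpha> \<beta>) = 2 ^ mdeg n \<alpha>"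
proof -
  have "(\<Sum>\<beta>\<in>below \<alpha>. mbinom n \<alpha> \<beta>) = (\<Prod>p\<in>Idx n. \<Sum>b\<in>{..\<alpha> p}. real (\<alpha> p choose b))"
    unfolding below_eq_PiE_dflt[OF assms] mbinom_def
    by (rule prod_sum_PiE_dflt[symmetric]) auto
  also have "\<dots> = (\<Prod>p\<in>Idx n. 2 ^ \<alpha> p)"
    by (intro prod.cong refl) (metis choose_row_sum of_nat_numeral of_nat_power of_nat_sum)
  finally show ?thesis by (simp add: mdeg_def power_sum)
qed

text \<open>\<open>detached \<alpha>\<close>: the multigraph \<open>\<alpha>\<close> has a nonempty union \<open>S\<close> of components avoiding vertex 0.\<close>
definition detached :: "(nat \<times> nat \<Rightarrow> nat) \<Rightarrow> bool" where
  "detached \<alpha> \<longleftrightarrow> (\<exists>S. 0 \<notin> S \<and> (\<forall>p. \<alpha> p \<noteq> 0 \<longrightarrow> (fst p \<in> S \<longleftrightarrow> snd p \<in> S)) \<and> (\<exists>p. \<alpha> p \<noteq> 0 \<and> fst p \<in> S))"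

text \<open>Split \<alpha> into \<alpha>2, its edges inside S, and \<alpha>1, the others. A proper
  \<beta> using an edge inside S vanishes by induction with the same S. The others are exactly the
  \<beta> below \<alpha>1, including \<alpha>1 itself; from their terms the moment of \<alpha>2
  factors out, and the convolution identity at \<alpha>1 turns the sum into the leading term, which
  it cancels.\<close>

lemma kappa_detached_aux:
  assumes "0 < n" "0 \<le> rho" "rho \<le> 1" "0 \<notin> S"
  assumes "\<alpha> \<in> msupp n" "\<forall>p. \<alpha> p \<noteq> 0 \<longrightarrow> (fst p \<in> S \<longleftrightarrow> snd p \<in> S)" "\<exists>p. \<alpha> p \<noteq> 0 \<and> fst p \<in> S"
  shows "kappa n rho lam \<alpha> = 0"
  using assms(5-)
proof (induction "mdeg n \<alpha>" arbitrary: \<alpha> rule: less_induct)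
  case less
  note \<alpha> = less.prems
  define \<alpha>1 where "\<alpha>1 = (\<lambda>p. if fst p \<in> S then 0 else \<alpha> p)"
  define \<alpha>2 where "\<alpha>2 = (\<lambda>p. if fst p \<in> S then \<alpha> p else 0)"
  have \<alpha>1: "\<alpha>1 \<in> msupp n" and \<alpha>2: "\<alpha>2 \<in> msupp n"
    using \<alpha>(1) by (auto simp: \<alpha>1_def \<alpha>2_def msupp_def)
  have \<alpha>1_below: "\<alpha>1 \<in> below \<alpha>" by (auto simp: \<alpha>1_def below_def)
  have \<alpha>1_neq: "\<alpha>1 \<noteq> \<alpha>" using \<alpha>(3) by (auto simp: \<alpha>1_def fun_eq_iff)
  have deg: "mdeg n \<alpha> = mdeg n \<alpha>1 + mdeg n \<alpha>2"
    unfolding mdeg_def sum.distrib[symmetric] by (intro sum.cong refl) (simp add: \<alpha>1_def \<alpha>2_def)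
  have "\<forall>i\<in>verts \<alpha>1. i \<notin> S" "\<forall>i\<in>verts \<alpha>2. i \<in> S"
    using \<alpha>(2) unfolding ball_verts by (simp_all add: \<alpha>1_def \<alpha>2_def) metis+
  then have verts1: "verts \<alpha>1 \<subseteq> - S" and verts2: "verts \<alpha>2 \<subseteq> S"
    by blast+
  have EX: "EXmon n rho lam (\<lambda>p. \<alpha> p - \<beta> p) = EXmon n rho lam (\<lambda>p. \<alpha>1 p - \<beta> p) * EXmon n rho lam \<alpha>2"
    and mb: "mbinom n \<alpha> \<beta> = mbinom n \<alpha>1 \<beta>"
    if \<beta>: "\<beta> \<in> below \<alpha>1" for \<beta>
  proof -
    have \<beta>0: "\<beta> p = 0" if "fst p \<in> S" for p
      using belowD[OF \<beta>, of p] that by (simp add: \<alpha>1_def)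
    have eq: "verts (\<lambda>p. \<alpha> p - \<beta> p) = verts (\<lambda>p. \<alpha>1 p - \<beta> p) \<union> verts \<alpha>2"
    proof -
      have "{p. \<alpha> p - \<beta> p \<noteq> 0} = {p. \<alpha>1 p - \<beta> p \<noteq> 0} \<union> {p. \<alpha>2 p \<noteq> 0}"
        using \<beta>0 by (simp add: set_eq_iff \<alpha>1_def \<alpha>2_def)
      then show ?thesis unfolding verts_def by (simp only: UN_Un)
    qed
    have "verts (\<lambda>p. \<alpha>1 p - \<beta> p) \<subseteq> verts \<alpha>1"
      unfolding verts_def by (intro UN_mono) auto
    then have "verts (\<lambda>p. \<alpha>1 p - \<beta> p) \<inter> verts \<alpha>2 = {}"
      using verts1 verts2 by blast
    then have "card (verts (\<lambda>p. \<alpha> p - \<beta> p)) = card (verts (\<lambda>p. \<alpha>1 p - \<beta> p)) + card (verts \<alpha>2)"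
      unfolding eq using \<alpha>1 \<alpha>2 diff_msupp finite_verts by (intro card_Un_disjoint) blast+
    moreover have "mdeg n (\<lambda>p. \<alpha> p - \<beta> p) = mdeg n (\<lambda>p. \<alpha>1 p - \<beta> p) + mdeg n \<alpha>2"
      unfolding mdeg_def sum.distrib[symmetric] using \<beta>0 by (intro sum.cong refl) (simp add: \<alpha>1_def \<alpha>2_def)
    ultimately show "EXmon n rho lam (\<lambda>p. \<alpha> p - \<beta> p) = EXmon n rho lam (\<lambda>p. \<alpha>1 p - \<beta> p) * EXmon n rho lam \<alpha>2"
      using \<alpha>1 \<alpha>2 \<alpha>(1) diff_msupp assms(2,3) by (simp add: EXmon_eq power_add)
    show "mbinom n \<alpha> \<beta> = mbinom n \<alpha>1 \<beta>"
      unfolding mbinom_def using \<beta>0 by (intro prod.cong) (auto simp: \<alpha>1_def)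
  qed
  have Ev1: "Ev1Xmon n rho lam \<alpha> = Ev1Xmon n rho lam \<alpha>1 * EXmon n rho lam \<alpha>2"
  proof -
    have "{p. \<alpha> p \<noteq> 0} = {p. \<alpha>1 p \<noteq> 0} \<union> {p. \<alpha>2 p \<noteq> 0}"
      by (simp add: set_eq_iff \<alpha>1_def \<alpha>2_def)
    then have "verts \<alpha> = verts \<alpha>1 \<union> verts \<alpha>2"
      unfolding verts_def by (simp only: UN_Un)
    then have "insert 0 (verts \<alpha>) = insert 0 (verts \<alpha>1) \<union> verts \<alpha>2" by simp
    moreover have "insert 0 (verts \<alpha>1) \<inter> verts \<alpha>2 = {}"
      using verts1 verts2 assms(4) by blast
    ultimately have "card (insert 0 (verts \<alpha>)) = card (insert 0 (verts \<alpha>1)) + card (verts \<alpha>2)"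
      using \<alpha>1 \<alpha>2 finite_verts by (metis card_Un_disjoint finite_insert)
    then show ?thesis
      using \<alpha>(1) \<alpha>1 \<alpha>2 assms(1-3) deg by (simp add: Ev1Xmon_eq EXmon_eq power_add)
  qed
  have "(\<Sum>\<beta>\<in>below \<alpha> - {\<alpha>}. kappa n rho lam \<beta> * mbinom n \<alpha> \<beta> * EXmon n rho lam (\<lambda>p. \<alpha> p - \<beta> p))
    = (\<Sum>\<beta>\<in>below \<alpha>1. kappa n rho lam \<beta> * mbinom n \<alpha> \<beta> * EXmon n rho lam (\<lambda>p. \<alpha> p - \<beta> p))"
  proof (rule sum.mono_neutral_right)
    show "finite (below \<alpha> - {\<alpha>})" using finite_below[OF \<alpha>(1)] by simp
    have "below \<alpha>1 \<subseteq> below \<alpha>"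
      using belowD[OF \<alpha>1_below] unfolding below_def by (auto intro: order_trans)
    moreover have "\<alpha> \<notin> below \<alpha>1"
      using belowD[OF \<alpha>1_below] belowD[of \<alpha> \<alpha>1] \<alpha>1_neq by (metis antisym ext)
    ultimately show "below \<alpha>1 \<subseteq> below \<alpha> - {\<alpha>}" by blast
    show "\<forall>\<beta>\<in>below \<alpha> - {\<alpha>} - below \<alpha>1.
      kappa n rho lam \<beta> * mbinom n \<alpha> \<beta> * EXmon n rho lam (\<lambda>p. \<alpha> p - \<beta> p) = 0"
    proof
      fix \<beta> assume \<beta>: "\<beta> \<in> below \<alpha> - {\<alpha>} - below \<alpha>1"
      then obtain p where p: "\<not> \<beta> p \<le> \<alpha>1 p" by (auto simp: below_def)
      have le: "\<beta> p \<le> \<alpha> p" for p using \<beta> by (simp add: below_def)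
      have "kappa n rho lam \<beta> = 0"
      proof (rule less.hyps)
        show "mdeg n \<beta> < mdeg n \<alpha>" using \<beta> mdeg_below_less[OF \<alpha>(1)] by blast
        show "\<beta> \<in> msupp n" using \<beta> below_msupp[OF \<alpha>(1)] by blast
        show "\<forall>p. \<beta> p \<noteq> 0 \<longrightarrow> (fst p \<in> S) = (snd p \<in> S)"
        proof (intro allI impI)
          fix p assume "\<beta> p \<noteq> 0"
          then have "\<alpha> p \<noteq> 0" using le[of p] by simp
          then show "(fst p \<in> S) = (snd p \<in> S)" using \<alpha>(2) by blast
        qed
        show "\<exists>p. \<beta> p \<noteq> 0 \<and> fst p \<in> S"
          using p le[of p] by (intro exI[of _ p]) (auto simp: \<alpha>1_def split: if_splits)
      qed
      then show "kappa n rho lam \<beta> * mbinom n \<alpha> \<beta> * EXmon n rho lam (\<lambda>p. \<alpha> p - \<beta> p) = 0" by simp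
    qed
  qed
  also have "\<dots> = (\<Sum>\<beta>\<in>below \<alpha>1. kappa n rho lam \<beta> * mbinom n \<alpha>1 \<beta> * EXmon n rho lam (\<lambda>p. \<alpha>1 p - \<beta> p)) * EXmon n rho lam \<alpha>2"
    unfolding sum_distrib_right by (intro sum.cong refl) (simp add: EX mb)
  also have "\<dots> = Ev1Xmon n rho lam \<alpha>"
    by (simp add: sum_kappa_below[OF \<alpha>1] Ev1)
  finally show ?case by (simp add: kappa_rec[OF \<alpha>(1)])
qed

lemma kappa_detached:
  assumes "0 < n" "0 \<le> rho" "rho \<le> 1" "\<alpha> \<in> msupp n" "detached \<alpha>"
  shows "kappa n rho lam \<alpha> = 0"
  using assms(5) kappa_detached_aux[OF assms(1-3) _ assms(4)] unfolding detached_def by blast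

text \<open>Together the two parts cover all vertices of \<alpha>. If they shared none, with 0
  counted on the side of \<beta>, the vertices of \<alpha> - \<beta> would form a union of
  components avoiding 0. So they overlap, and inclusion-exclusion gives the extra 1.\<close>

lemma card_verts_split:
  assumes "\<alpha> \<in> msupp n" "\<not> detached \<alpha>" "\<beta> \<in> below \<alpha>" "\<beta> \<noteq> \<alpha>"
  shows "card (insert 0 (verts \<alpha>)) + 1 \<le> card (insert 0 (verts \<beta>)) + card (verts (\<lambda>p. \<alpha> p - \<beta> p))"
proof -
  let ?\<gamma> = "\<lambda>p. \<alpha> p - \<beta> p"
  let ?A = "insert 0 (verts \<beta>)" and ?B = "verts ?\<gamma>"
  have fin: "finite ?A" "finite ?B"
    using assms below_msupp diff_msupp finite_verts by blast+
  have le: "\<beta> p \<le> \<alpha> p" for p using assms(3) by (simp add: below_def)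
  have meet: "?A \<inter> ?B \<noteq> {}"
  proof
    assume disj: "?A \<inter> ?B = {}"
    have "detached \<alpha>" unfolding detached_def
    proof (intro exI[of _ ?B] conjI allI impI)
      show "0 \<notin> ?B" using disj by blast
      fix p assume p: "\<alpha> p \<noteq> 0"
      show "(fst p \<in> ?B) = (snd p \<in> ?B)"
      proof (cases "\<beta> p = 0")
        case True
        then have "?\<gamma> p \<noteq> 0" using p by simp
        then show ?thesis using fst_in_verts[of ?\<gamma> p] snd_in_verts[of ?\<gamma> p] by simp
      next
        case False
        then have "fst p \<in> ?A" "snd p \<in> ?A" by (simp_all add: fst_in_verts snd_in_verts)
        then show ?thesis using disj by blast
      qed
    next
      obtain p where "\<beta> p \<noteq> \<alpha> p" using assms(4) by blast
      then have "?\<gamma> p \<noteq> 0" using le[of p] by simp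
      then show "\<exists>p. \<alpha> p \<noteq> 0 \<and> fst p \<in> ?B"
        using fst_in_verts[of ?\<gamma> p] by (intro exI[of _ p]) auto
    qed
    then show False using assms(2) by simp
  qed
  have "insert 0 (verts \<alpha>) \<subseteq> ?A \<union> ?B"
  proof -
    have "\<forall>i\<in>verts \<alpha>. i \<in> ?A \<union> ?B" unfolding ball_verts
    proof (intro allI impI)
      fix p assume "\<alpha> p \<noteq> 0"
      then have "\<beta> p \<noteq> 0 \<or> ?\<gamma> p \<noteq> 0" by auto
      then show "fst p \<in> ?A \<union> ?B \<and> snd p \<in> ?A \<union> ?B"
        using fst_in_verts[of \<beta> p] snd_in_verts[of \<beta> p] fst_in_verts[of ?\<gamma> p] snd_in_verts[of ?\<gamma> p]
        by auto
    qed
    then show ?thesis by blast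
  qed
  then have "card (insert 0 (verts \<alpha>)) \<le> card (?A \<union> ?B)" using fin by (intro card_mono) auto
  moreover have "card (?A \<union> ?B) + card (?A \<inter> ?B) = card ?A + card ?B"
    using fin card_Un_Int by metis
  moreover have "card (?A \<inter> ?B) \<ge> 1" using meet fin by (simp add: Suc_le_eq card_gt_0_iff)
  ultimately show ?thesis by linarith
qed

text \<open>The claims sustain each other: nonnegativity below \<alpha> makes the subtracted sum
  nonnegative, giving the upper bound at \<alpha>; the upper bounds below \<alpha> limit that sum to
  half the leading term, giving the lower bound and hence nonnegativity at \<alpha>.\<close>

lemma kappa_bounds:
  assumes "0 < n" "0 < rho" "rho < 1" "0 \<le> lam" "2 ^ D * rho \<le> 1 / 2"
  assumes "\<alpha> \<in> msupp n" "mdeg n \<alpha> \<le> D"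
  shows "0 \<le> kappa n rho lam \<alpha> \<and>
    kappa n rho lam \<alpha> \<le> lam ^ mdeg n \<alpha> * rho ^ card (insert 0 (verts \<alpha>)) \<and>
    (\<not> detached \<alpha> \<longrightarrow> lam ^ mdeg n \<alpha> * rho ^ card (insert 0 (verts \<alpha>)) / 2 \<le> kappa n rho lam \<alpha>)"
  using assms(6,7)
proof (induction "mdeg n \<alpha>" arbitrary: \<alpha> rule: less_induct)
  case less
  let ?t = "\<lambda>\<alpha>. lam ^ mdeg n \<alpha> * rho ^ card (insert 0 (verts \<alpha>))"
  let ?s = "\<lambda>\<beta>. kappa n rho lam \<beta> * mbinom n \<alpha> \<beta> * EXmon n rho lam (\<lambda>p. \<alpha> p - \<beta> p)"
  show ?case
  proof (cases "detached \<alpha>")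
    case True
    then show ?thesis using kappa_detached[OF assms(1) _ _ less.prems(1)] assms by simp
  next
    case False
    have mb: "0 \<le> mbinom n \<alpha> \<beta>" for \<beta> unfolding mbinom_def by (intro prod_nonneg) simp
    have IH: "0 \<le> kappa n rho lam \<beta>" "kappa n rho lam \<beta> \<le> ?t \<beta>" if "\<beta> \<in> below \<alpha> - {\<alpha>}" for \<beta>
      using less.hyps[of \<beta>] that mdeg_below_less[OF less.prems(1), of \<beta>] below_msupp[OF less.prems(1)] less.prems(2)
      by auto
    have EX: "EXmon n rho lam (\<lambda>p. \<alpha> p - \<beta> p) =
        lam ^ mdeg n (\<lambda>p. \<alpha> p - \<beta> p) * rho ^ card (verts (\<lambda>p. \<alpha> p - \<beta> p))" for \<beta>
      using EXmon_eq[OF diff_msupp[OF less.prems(1)]] assms by simp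
    have nonneg: "0 \<le> ?s \<beta>" if "\<beta> \<in> below \<alpha> - {\<alpha>}" for \<beta>
      unfolding EX using IH(1)[OF that] mb assms by simp
    have le: "?s \<beta> \<le> ?t \<alpha> * rho * mbinom n \<alpha> \<beta>" if \<beta>: "\<beta> \<in> below \<alpha> - {\<alpha>}" for \<beta>
    proof -
      have "?s \<beta> \<le> ?t \<beta> * mbinom n \<alpha> \<beta> * (lam ^ mdeg n (\<lambda>p. \<alpha> p - \<beta> p) * rho ^ card (verts (\<lambda>p. \<alpha> p - \<beta> p)))"
        unfolding EX using IH(2)[OF \<beta>] mb assms by (intro mult_right_mono) simp_all
      also have "\<dots> = lam ^ (mdeg n \<beta> + mdeg n (\<lambda>p. \<alpha> p - \<beta> p)) * mbinom n \<alpha> \<beta> *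
          rho ^ (card (insert 0 (verts \<beta>)) + card (verts (\<lambda>p. \<alpha> p - \<beta> p)))"
        by (simp add: power_add)
      also have "mdeg n \<beta> + mdeg n (\<lambda>p. \<alpha> p - \<beta> p) = mdeg n \<alpha>" using \<beta> mdeg_below_diff by blast
      also have "lam ^ mdeg n \<alpha> * mbinom n \<alpha> \<beta> *
          rho ^ (card (insert 0 (verts \<beta>)) + card (verts (\<lambda>p. \<alpha> p - \<beta> p)))
        \<le> lam ^ mdeg n \<alpha> * mbinom n \<alpha> \<beta> * rho ^ (card (insert 0 (verts \<alpha>)) + 1)"
        using card_verts_split[OF less.prems(1) False, of \<beta>] \<beta> mb assms
        by (intro mult_left_mono power_decreasing) auto
      finally show ?thesis by (simp add: mult_ac)
    qed
    have "sum ?s (below \<alpha> - {\<alpha>}) \<le> (\<Sum>\<beta>\<in>below \<alpha> - {\<alpha>}. ?t \<alpha> * rho * mbinom n \<alpha> \<beta>)"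
      by (intro sum_mono le)
    \<comment> \<open>The term \<beta> = \<alpha> is put back so that the binomials add up to
      exactly 2^|\<alpha>|.\<close>
    also have "\<dots> \<le> (\<Sum>\<beta>\<in>below \<alpha>. ?t \<alpha> * rho * mbinom n \<alpha> \<beta>)"
      using finite_below[OF less.prems(1)] mb assms by (intro sum_mono2) auto
    also have "\<dots> = ?t \<alpha> * (rho * 2 ^ mdeg n \<alpha>)"
      by (simp add: sum_mbinom_below[OF less.prems(1)] mult.assoc flip: sum_distrib_left)
    also have "\<dots> \<le> ?t \<alpha> * (1 / 2)"
    proof (intro mult_left_mono)
      have "rho * 2 ^ mdeg n \<alpha> \<le> rho * 2 ^ D"
        using less.prems(2) assms by (intro mult_left_mono power_increasing) auto
      then show "rho * 2 ^ mdeg n \<alpha> \<le> 1 / 2" using assms(5) by (simp add: mult.commute)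
    qed (use assms in simp)
    finally have "sum ?s (below \<alpha> - {\<alpha>}) \<le> ?t \<alpha> / 2" by simp
    moreover have "0 \<le> sum ?s (below \<alpha> - {\<alpha>})" by (intro sum_nonneg nonneg)
    moreover have "kappa n rho lam \<alpha> = ?t \<alpha> - sum ?s (below \<alpha> - {\<alpha>})"
      using kappa_rec[OF less.prems(1), of rho lam] Ev1Xmon_eq[OF less.prems(1) assms(1), of rho lam] assms by simp
    moreover have "0 \<le> ?t \<alpha>" using assms by simp
    ultimately show ?thesis by linarith
  qed
qed

section \<open>Counting connected multigraphs\<close>

definition edge :: "nat \<Rightarrow> nat \<Rightarrow> nat \<times> nat" where
  "edge u v = (min u v, max u v)"

text \<open>All multiplicities are 0 or 1, even if two vertices yield the same edge. The number of
  edges is thus \<open>card A\<close> only under the injectivity assumed in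
  \<open>mdeg_parent_graph\<close>.\<close>

definition parent_graph :: "nat set \<Rightarrow> (nat \<Rightarrow> nat) \<Rightarrow> nat \<times> nat \<Rightarrow> nat" where
  "parent_graph A f p = of_bool (\<exists>v\<in>A. p = edge v (f v))"

lemma edge_commute: "edge u v = edge v u"
  by (simp add: edge_def min.commute max.commute)

lemma edge_eq_iff: "edge u v = edge w x \<longleftrightarrow> u = w \<and> v = x \<or> u = x \<and> v = w"
  by (auto simp: edge_def min_def max_def)

lemma edge_in_Idx [simp]: "edge u v \<in> Idx n \<longleftrightarrow> u < n \<and> v < n"
  by (auto simp: edge_def Idx_def)

lemma edge_fst_snd: "p \<in> Idx n \<Longrightarrow> edge (fst p) (snd p) = p"
  by (auto simp: edge_def Idx_def)

lemma edge_in_verts: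
  assumes "\<alpha> (edge u v) \<noteq> 0"
  shows "u \<in> verts \<alpha>" "v \<in> verts \<alpha>"
  using fst_in_verts[of \<alpha> "edge u v", OF assms] snd_in_verts[of \<alpha> "edge u v", OF assms] by (auto simp: edge_def min_def max_def split: if_splits)

lemma mdeg_parent_graph:
  assumes "inj_on (\<lambda>v. edge v (f v)) A" "\<And>v. v \<in> A \<Longrightarrow> edge v (f v) \<in> Idx n"
  shows "mdeg n (parent_graph A f) = card A"
proof -
  have "mdeg n (parent_graph A f) = card (Idx n \<inter> {p. \<exists>v\<in>A. p = edge v (f v)})"
    by (simp add: mdeg_def parent_graph_def Int_def of_bool_def flip: sum.inter_filter)
  also have "Idx n \<inter> {p. \<exists>v\<in>A. p = edge v (f v)} = (\<lambda>v. edge v (f v)) ` A"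
    using assms(2) by auto
  finally show ?thesis using assms(1) by (simp add: card_image)
qed

lemma parent_graph_below:
  assumes "\<forall>v\<in>A. \<alpha> (edge v (f v)) \<noteq> 0"
  shows "parent_graph A f \<in> below \<alpha>"
  unfolding below_def
proof (intro CollectI allI)
  fix p
  show "parent_graph A f p \<le> \<alpha> p"
  proof (cases "\<exists>v\<in>A. p = edge v (f v)")
    case True
    then have "\<alpha> p \<noteq> 0" using assms by blast
    then show ?thesis by (simp add: parent_graph_def)
  qed (simp add: parent_graph_def)
qed

text \<open>Breadth-first search from 0: the parent of a vertex is a neighbour at strictly smaller
  distance. If two distinct vertices gave the same edge, each would be the parent of the other, and
  both distances would decrease.\<close>

lemma exists_parent_function:
  assumes \<alpha>: "\<alpha> \<in> msupp n" "\<not> detached \<alpha>"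
  defines "A \<equiv> verts \<alpha> - {0}"
  shows "\<exists>f. f \<in> A \<rightarrow>\<^sub>E insert 0 A \<and> inj_on (\<lambda>v. edge v (f v)) A \<and> (\<forall>v\<in>A. \<alpha> (edge v (f v)) \<noteq> 0)"
proof -
  define E where "E = {(u, v). \<alpha> (edge u v) \<noteq> 0}"
  have symE: "(u, v) \<in> E \<longleftrightarrow> (v, u) \<in> E" for u v by (simp add: E_def edge_commute)
  have reach: "(0, v) \<in> E\<^sup>*" if "v \<in> verts \<alpha>" for v
  proof -
    \<comment> \<open>The unreachable vertices would witness that \<alpha> is detached if any edge
      met them.\<close>
    define S where "S = {v. (0, v) \<notin> E\<^sup>*}"
    have endpoints: "fst p \<in> S \<longleftrightarrow> snd p \<in> S" if "\<alpha> p \<noteq> 0" for p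
    proof -
      have "p \<in> Idx n" using \<alpha>(1) that unfolding msupp_def by auto
      then have "(fst p, snd p) \<in> E" using that by (simp add: E_def edge_fst_snd case_prod_unfold)
      then show ?thesis using symE[of "fst p" "snd p"] unfolding S_def
        by (auto intro: rtrancl_into_rtrancl)
    qed
    have "\<not> (\<exists>p. \<alpha> p \<noteq> 0 \<and> fst p \<in> S)"
    proof
      assume ex: "\<exists>p. \<alpha> p \<noteq> 0 \<and> fst p \<in> S"
      have "detached \<alpha>" unfolding detached_def
        using endpoints ex by (intro exI[of _ S]) (simp add: S_def)
      then show False using \<alpha>(2) by simp
    qed
    then have "\<forall>v\<in>verts \<alpha>. v \<notin> S" unfolding ball_verts using endpoints by blast
    then show ?thesis using that by (auto simp: S_def)
  qed
  define dist where "dist v = (LEAST k. (0, v) \<in> E ^^ k)" for v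
  have "\<exists>u. u \<in> insert 0 A \<and> \<alpha> (edge v u) \<noteq> 0 \<and> dist u < dist v" if v: "v \<in> A" for v
  proof -
    have "\<exists>k. (0, v) \<in> E ^^ k" using reach[of v] v by (auto simp: A_def rtrancl_is_UN_relpow)
    then have d: "(0, v) \<in> E ^^ dist v" unfolding dist_def by (rule LeastI_ex)
    have "dist v \<noteq> 0"
    proof
      assume "dist v = 0"
      then show False using d v by (simp add: A_def)
    qed
    then obtain m where m: "dist v = Suc m" using not0_implies_Suc by blast
    then obtain u where u: "(0, u) \<in> E ^^ m" "(u, v) \<in> E" using d by auto
    have "dist u \<le> m" unfolding dist_def using u(1) by (rule Least_le)
    moreover have a: "\<alpha> (edge v u) \<noteq> 0" using u(2) by (simp add: E_def edge_commute)
    moreover have "u \<in> insert 0 A" using edge_in_verts(2)[of \<alpha> v u, OF a] by (auto simp: A_def)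
    ultimately show ?thesis using m by (intro exI[of _ u]) auto
  qed
  then obtain g where g: "\<And>v. v \<in> A \<Longrightarrow> g v \<in> insert 0 A \<and> \<alpha> (edge v (g v)) \<noteq> 0 \<and> dist (g v) < dist v"
    by metis
  show ?thesis
  proof (intro exI[of _ "restrict g A"] conjI ballI)
    show "restrict g A \<in> A \<rightarrow>\<^sub>E insert 0 A" using g by simp
    show "inj_on (\<lambda>v. edge v (restrict g A v)) A"
    proof (rule inj_onI)
      fix v w assume vw: "v \<in> A" "w \<in> A" "edge v (restrict g A v) = edge w (restrict g A w)"
      then have "v = w \<or> v = g w \<and> g v = w" by (auto simp: edge_eq_iff)
      then show "v = w" using g[OF vw(1)] g[OF vw(2)] by auto
    qed
    show "\<alpha> (edge v (restrict g A v)) \<noteq> 0" if "v \<in> A" for v using g that by simp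
  qed
qed

text \<open>Turns a family of excess edges into a word, because words of given length over a finite
  alphabet have a simple exact count. Forgetting the order only overcounts, which is harmless for an
  upper bound.\<close>

lemma exists_list_count:
  fixes \<gamma> :: "'a \<Rightarrow> nat"
  assumes "finite I" "\<And>p. p \<notin> I \<Longrightarrow> \<gamma> p = 0"
  obtains xs where "set xs \<subseteq> I" "length xs = sum \<gamma> I" "\<gamma> = count_list xs"
proof -
  define M where "M = (\<Sum>p\<in>I. replicate_mset (\<gamma> p) p)"
  obtain xs where xs: "mset xs = M" using ex_mset by blast
  have "count M q = \<gamma> q" for q
  proof -
    have "count M q = (\<Sum>p\<in>I. if p = q then \<gamma> p else 0)"
      by (auto simp: M_def count_sum intro!: sum.cong)
    then show ?thesis using assms by (simp add: sum.delta')
  qed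
  then have cnt: "\<gamma> = count_list xs" using xs by (auto simp: fun_eq_iff count_mset[symmetric])
  have "size M = sum \<gamma> I" by (simp add: M_def)
  then have len: "length xs = sum \<gamma> I" using xs size_mset by metis
  have "set xs \<subseteq> I"
  proof
    fix p assume "p \<in> set xs"
    then have "count_list xs p \<noteq> 0" by (simp add: count_list_0_iff)
    then show "p \<in> I" using assms(2) cnt by metis
  qed
  then show ?thesis using that len cnt by blast
qed

text \<open>Every such multigraph is decoded from a vertex set A of size m without 0, a parent
  function on A, and a word of l excess edges. The factors are the numbers of choices; an excess
  edge is any ordered pair from m + 1 vertices.\<close>

lemma card_attached_le:
  "card {\<alpha> \<in> msupp n. \<not> detached \<alpha> \<and> card (verts \<alpha> - {0}) = m \<and> mdeg n \<alpha> = m + l}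
     \<le> ((n - 1) choose m) * ((m + 1) ^ m * ((m + 1)\<^sup>2) ^ l)"
  (is "card ?N \<le> _")
proof -
  define Dom where "Dom = (SIGMA A:{A. A \<subseteq> {1..<n} \<and> card A = m}.
    (A \<rightarrow>\<^sub>E insert 0 A) \<times> {xs. set xs \<subseteq> insert 0 A \<times> insert 0 A \<and> length xs = l})"
  define enc where "enc = (\<lambda>(A, f, xs) p. parent_graph A f p + count_list xs p)"
  have fin: "finite A" if "A \<subseteq> {1..<n}" for A using that finite_subset by blast
  have finA: "finite {A. A \<subseteq> {1..<n} \<and> card A = m}" by (rule finite_subset[of _ "Pow {1..<n}"]) auto
  have finDom: "finite Dom" unfolding Dom_def
    using finA fin by (intro finite_SigmaI finite_cartesian_product finite_PiE finite_lists_length_eq) auto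
  have "card Dom = (\<Sum>A\<in>{A. A \<subseteq> {1..<n} \<and> card A = m}. (m + 1) ^ m * ((m + 1)\<^sup>2) ^ l)"
    unfolding Dom_def
  proof (subst card_SigmaI)
    show "(\<Sum>A\<in>{A. A \<subseteq> {1..<n} \<and> card A = m}. card ((A \<rightarrow>\<^sub>E insert 0 A) \<times>
      {xs. set xs \<subseteq> insert 0 A \<times> insert 0 A \<and> length xs = l})) =
      (\<Sum>A\<in>{A. A \<subseteq> {1..<n} \<and> card A = m}. (m + 1) ^ m * ((m + 1)\<^sup>2) ^ l)"
    proof (intro sum.cong refl)
      fix A assume A: "A \<in> {A. A \<subseteq> {1..<n} \<and> card A = m}"
      then have c: "card (insert 0 A) = m + 1" and f: "finite A" using fin[of A] by (auto simp: card_insert_if)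
      then show "card ((A \<rightarrow>\<^sub>E insert 0 A) \<times> {xs. set xs \<subseteq> insert 0 A \<times> insert 0 A \<and> length xs = l})
        = (m + 1) ^ m * ((m + 1)\<^sup>2) ^ l"
        using A by (simp only: card_cartesian_product card_PiE card_lists_length_eq finite_cartesian_product
          finite_insert prod_constant mem_Collect_eq power2_eq_square simp_thms)
    qed
  qed (use finA fin in \<open>auto intro!: finite_PiE finite_lists_length_eq\<close>)
  also have "\<dots> = ((n - 1) choose m) * ((m + 1) ^ m * ((m + 1)\<^sup>2) ^ l)"
    using n_subsets[of "{1..<n}" m] by simp
  finally have cardDom: "card Dom = ((n - 1) choose m) * ((m + 1) ^ m * ((m + 1)\<^sup>2) ^ l)" .
  have "?N \<subseteq> enc ` Dom"
  proof
    fix \<alpha> assume "\<alpha> \<in> ?N"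
    then have \<alpha>: "\<alpha> \<in> msupp n" "\<not> detached \<alpha>" "card (verts \<alpha> - {0}) = m" "mdeg n \<alpha> = m + l" by auto
    define A where "A = verts \<alpha> - {0}"
    obtain f where f: "f \<in> A \<rightarrow>\<^sub>E insert 0 A" "inj_on (\<lambda>v. edge v (f v)) A"
      "\<forall>v\<in>A. \<alpha> (edge v (f v)) \<noteq> 0"
      using exists_parent_function[OF \<alpha>(1,2)] unfolding A_def by blast
    have A: "A \<subseteq> {1..<n}" using verts_subset[OF \<alpha>(1)] by (auto simp: A_def)
    have cA: "card A = m" using \<alpha>(3) by (simp add: A_def)
    have T: "parent_graph A f \<in> below \<alpha>" by (rule parent_graph_below[OF f(3)])
    have eI: "edge v (f v) \<in> Idx n" if "v \<in> A" for v
      using f(3) that \<alpha>(1) unfolding msupp_def mem_Collect_eq by metis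
    define \<gamma> where "\<gamma> = (\<lambda>p. \<alpha> p - parent_graph A f p)"
    have \<gamma>: "\<gamma> \<in> msupp n" unfolding \<gamma>_def by (rule diff_msupp[OF \<alpha>(1)])
    have deg\<gamma>: "mdeg n \<gamma> = l"
      using mdeg_below_diff[OF T, of n] mdeg_parent_graph[OF f(2) eI] \<alpha>(3,4) by (simp add: \<gamma>_def A_def)
    obtain xs where xs: "set xs \<subseteq> Idx n" "length xs = sum \<gamma> (Idx n)" "\<gamma> = count_list xs"
      using exists_list_count[of "Idx n" \<gamma>] \<gamma> unfolding msupp_def by auto
    have "set xs \<subseteq> insert 0 A \<times> insert 0 A"
    proof
      fix p assume "p \<in> set xs"
      then have "\<gamma> p \<noteq> 0" using xs(3) by (simp add: count_list_0_iff)
      then have "\<alpha> p \<noteq> 0" by (auto simp: \<gamma>_def)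
      then have "fst p \<in> insert 0 A" "snd p \<in> insert 0 A"
        using fst_in_verts[of \<alpha> p] snd_in_verts[of \<alpha> p] by (auto simp: A_def)
      then show "p \<in> insert 0 A \<times> insert 0 A" by (simp only: mem_Times_iff simp_thms)
    qed
    then have "(A, f, xs) \<in> Dom"
      using A cA f(1) xs(2) deg\<gamma> unfolding Dom_def mdeg_def by blast
    moreover have "enc (A, f, xs) = \<alpha>"
      using belowD[OF T] by (simp add: enc_def fun_eq_iff flip: xs(3)) (simp add: \<gamma>_def)
    ultimately show "\<alpha> \<in> enc ` Dom" by (metis imageI)
  qed
  then have "card ?N \<le> card (enc ` Dom)" using finDom by (intro card_mono) auto
  also have "\<dots> \<le> card Dom" by (rule card_image_le[OF finDom])
  finally show ?thesis unfolding cardDom .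
qed

text \<open>Passing from m to m + 1 multiplies (m+1)^m / m! by (1 + 1/(m+1))^(m+1), which is at most
  e.\<close>

lemma power_le_exp_fact: "real (m + 1) ^ m \<le> exp (real m) * fact m"
proof (induction m)
  case (Suc m)
  have "(1 + 1 / real (m + 1)) ^ (m + 1) \<le> exp (1 / real (m + 1)) ^ (m + 1)"
    by (intro power_mono exp_ge_add_one_self) simp
  also have "\<dots> = exp 1"
    by (subst exp_of_nat_mult[symmetric]) (simp del: of_nat_Suc)
  finally have e: "(1 + 1 / real (m + 1)) ^ (m + 1) \<le> exp 1" .
  have "real (Suc m + 1) ^ Suc m = (1 + 1 / real (m + 1)) ^ (m + 1) * real (m + 1) ^ (m + 1)"
  proof -
    have "real (Suc m + 1) = (1 + 1 / real (m + 1)) * real (m + 1)" by (simp add: field_simps)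
    then show ?thesis by (simp only: power_mult_distrib Suc_eq_plus1)
  qed
  also have "\<dots> \<le> exp 1 * (real (m + 1) * (exp (real m) * fact m))"
    using e Suc.IH by (intro mult_mono) auto
  finally show ?case by (simp add: exp_add mult_ac)
qed simp

lemma sum_power_le_inverse:
  fixes x :: real
  assumes "0 \<le> x" "x < 1"
  shows "(\<Sum>i\<le>D. x ^ i) \<le> 1 / (1 - x)"
  using sum_le_suminf[OF summable_geometric, of x "{..D}"] suminf_geometric[of x] assms by simp

text \<open>The class with m non-root vertices and l excess edges contributes at most rho^2 r^m
  3^(-l). The m! from \<open>power_le_exp_fact\<close> cancels against the binomial, leaving a
  factor e n lam^2 rho^2 \<le> r per vertex; an excess edge costs (m+1)^2 lam^2 \<le> D^2 lam^2
  \<le> r^2 / 3.\<close>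

lemma sum_kappa_upper:
  assumes "0 < n" "0 < rho" "rho < 1" "0 \<le> lam" "2 ^ D * rho \<le> 1 / 2"
    and "0 < r" "r < 1" "lam\<^sup>2 \<le> r / (exp 1 * rho\<^sup>2 * real n)"
    and "(real D)\<^sup>2 \<le> exp 1 / 3 * r * rho\<^sup>2 * real n"
  shows "(\<Sum>\<alpha>\<in>Mons n D. (kappa n rho lam \<alpha>)\<^sup>2 / mfact n \<alpha>) \<le> 2 * rho\<^sup>2 / (1 - r)\<^sup>2"
proof -
  let ?w = "\<lambda>m l. (lam ^ (m + l) * rho ^ (m + 1))\<^sup>2"
  let ?P = "{..D} \<times> {..D}"
  define G where "G = {\<alpha> \<in> Mons n D. \<not> detached \<alpha>}"
  define g where "g = (\<lambda>\<alpha>. (card (verts \<alpha> - {0}), mdeg n \<alpha> - card (verts \<alpha> - {0})))"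
  have finG: "finite G" by (simp add: G_def)
  \<comment> \<open>A spanning tree with as many edges as non-root vertices lies below \<alpha>, so
    the truncated subtraction in \<open>g\<close> is exact.\<close>
  have gG: "fst (g \<alpha>) + snd (g \<alpha>) = mdeg n \<alpha> \<and> mdeg n \<alpha> \<le> D" if "\<alpha> \<in> G" for \<alpha>
  proof -
    have \<alpha>: "\<alpha> \<in> msupp n" "mdeg n \<alpha> \<le> D" "\<not> detached \<alpha>" using that by (auto simp: G_def Mons_eq)
    obtain f where f: "inj_on (\<lambda>v. edge v (f v)) (verts \<alpha> - {0})"
      "\<forall>v\<in>verts \<alpha> - {0}. \<alpha> (edge v (f v)) \<noteq> 0"
      using exists_parent_function[OF \<alpha>(1,3)] by blast
    have T: "parent_graph (verts \<alpha> - {0}) f \<in> below \<alpha>"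
      by (rule parent_graph_below[OF f(2)])
    have eI: "edge v (f v) \<in> Idx n" if "v \<in> verts \<alpha> - {0}" for v
      using f(2) that \<alpha>(1) unfolding msupp_def mem_Collect_eq by metis
    show ?thesis
      using mdeg_below_diff[OF T, of n] mdeg_parent_graph[OF f(1) eI] \<alpha>(2) by (simp add: g_def)
  qed
  have "(\<Sum>\<alpha>\<in>Mons n D. (kappa n rho lam \<alpha>)\<^sup>2 / mfact n \<alpha>) = (\<Sum>\<alpha>\<in>G. (kappa n rho lam \<alpha>)\<^sup>2 / mfact n \<alpha>)"
  proof (rule sum.mono_neutral_right)
    show "\<forall>\<alpha>\<in>Mons n D - G. (kappa n rho lam \<alpha>)\<^sup>2 / mfact n \<alpha> = 0"
      using kappa_detached[OF assms(1)] assms(2,3) by (auto simp: G_def Mons_eq)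
  qed (auto simp: G_def)
  also have "\<dots> \<le> (\<Sum>\<alpha>\<in>G. ?w (fst (g \<alpha>)) (snd (g \<alpha>)))"
  proof (rule sum_mono)
    fix \<alpha> assume "\<alpha> \<in> G"
    then have \<alpha>: "\<alpha> \<in> msupp n" "mdeg n \<alpha> \<le> D" by (auto simp: G_def Mons_eq)
    have "card (insert 0 (verts \<alpha>)) = fst (g \<alpha>) + 1"
      using finite_verts[OF \<alpha>(1)] unfolding g_def fst_conv by (simp only: card.insert_remove Suc_eq_plus1)
    then have k: "0 \<le> kappa n rho lam \<alpha>"
      "kappa n rho lam \<alpha> \<le> lam ^ (fst (g \<alpha>) + snd (g \<alpha>)) * rho ^ (fst (g \<alpha>) + 1)"
      using kappa_bounds[OF assms(1-5) \<alpha>] gG[OF \<open>\<alpha> \<in> G\<close>] by auto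
    have "(kappa n rho lam \<alpha>)\<^sup>2 / mfact n \<alpha> \<le> (kappa n rho lam \<alpha>)\<^sup>2 / 1"
      using mfact_ge_1[of n \<alpha>] by (intro divide_left_mono) auto
    also have "\<dots> \<le> ?w (fst (g \<alpha>)) (snd (g \<alpha>))"
      using k by (simp del: power_Suc add: power_mono)
    finally show "(kappa n rho lam \<alpha>)\<^sup>2 / mfact n \<alpha> \<le> ?w (fst (g \<alpha>)) (snd (g \<alpha>))" .
  qed
  also have "\<dots> = (\<Sum>q\<in>?P. \<Sum>\<alpha>\<in>{\<alpha>\<in>G. g \<alpha> = q}. ?w (fst (g \<alpha>)) (snd (g \<alpha>)))"
  proof (rule sum.group[symmetric])
    show "g ` G \<subseteq> ?P"
    proof (rule image_subsetI)
      fix \<alpha> assume "\<alpha> \<in> G"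
      then have "fst (g \<alpha>) \<le> D" "snd (g \<alpha>) \<le> D" using gG[of \<alpha>] by linarith+
      then show "g \<alpha> \<in> ?P" by (simp add: mem_Times_iff)
    qed
  qed (use finG in auto)
  also have "\<dots> \<le> (\<Sum>q\<in>?P. rho\<^sup>2 * (r ^ fst q * (1 / 3) ^ snd q))"
  proof (rule sum_mono)
    fix q assume "q \<in> ?P"
    obtain m l where q: "q = (m, l)" by (cases q)
    have "(\<Sum>\<alpha>\<in>{\<alpha>\<in>G. g \<alpha> = q}. ?w (fst (g \<alpha>)) (snd (g \<alpha>))) = real (card {\<alpha>\<in>G. g \<alpha> = q}) * ?w m l"
      by (simp add: q)
    also have "\<dots> \<le> rho\<^sup>2 * (r ^ m * (1 / 3) ^ l)"
    proof (cases "m + l \<le> D")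
      case False
      have "g \<alpha> \<noteq> q" if "\<alpha> \<in> G" for \<alpha>
      proof
        assume "g \<alpha> = q"
        then show False using gG[OF that] False by (simp add: q)
      qed
      then have "{\<alpha>\<in>G. g \<alpha> = q} = {}" by blast
      then have "card {\<alpha>\<in>G. g \<alpha> = q} = 0" by (simp only: card.empty)
      then show ?thesis using assms by simp
    next
      case True
      have "{\<alpha>\<in>G. g \<alpha> = q} \<subseteq> {\<alpha> \<in> msupp n. \<not> detached \<alpha> \<and> card (verts \<alpha> - {0}) = m \<and> mdeg n \<alpha> = m + l}"
      proof
        fix \<alpha> assume \<alpha>: "\<alpha> \<in> {\<alpha>\<in>G. g \<alpha> = q}"
        then show "\<alpha> \<in> {\<alpha> \<in> msupp n. \<not> detached \<alpha> \<and> card (verts \<alpha> - {0}) = m \<and> mdeg n \<alpha> = m + l}"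
          using gG[of \<alpha>] by (auto simp: q g_def G_def Mons_eq)
      qed
      moreover have "finite {\<alpha> \<in> msupp n. \<not> detached \<alpha> \<and> card (verts \<alpha> - {0}) = m \<and> mdeg n \<alpha> = m + l}"
        by (rule finite_subset[OF _ finite_Mons[of n "m + l"]]) (auto simp: Mons_eq)
      ultimately have "card {\<alpha>\<in>G. g \<alpha> = q} \<le> ((n - 1) choose m) * ((m + 1) ^ m * ((m + 1)\<^sup>2) ^ l)"
        using card_attached_le[of n m l] card_mono order_trans by blast
      then have "real (card {\<alpha>\<in>G. g \<alpha> = q}) \<le> real ((n - 1) choose m) * (real (m + 1) ^ m * ((real (m + 1))\<^sup>2) ^ l)"
        by (metis (no_types, lifting) of_nat_le_iff of_nat_mult of_nat_power)
      then have "real (card {\<alpha>\<in>G. g \<alpha> = q}) * ?w m l \<le>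
        real ((n - 1) choose m) * (real (m + 1) ^ m * ((real (m + 1))\<^sup>2) ^ l) * ?w m l"
        by (rule mult_right_mono) simp
      \<comment> \<open>Regroups the weight: one factor per non-root vertex and one per excess edge,
        with rho^2 left over for the root.\<close>
      also have "\<dots> = rho\<^sup>2 * ((real ((n - 1) choose m) * real (m + 1) ^ m * (lam\<^sup>2 * rho\<^sup>2) ^ m) * ((real (m + 1))\<^sup>2 * lam\<^sup>2) ^ l)"
        by (simp add: power_mult_distrib power_add power2_eq_square mult_ac)
      also have "\<dots> \<le> rho\<^sup>2 * (r ^ m * (1 / 3) ^ l)"
      proof (intro mult_left_mono mult_mono)
        have "real ((n - 1) choose m) * real (m + 1) ^ m \<le> real ((n - 1) choose m) * (exp (real m) * fact m)"
          by (intro mult_left_mono power_le_exp_fact) simp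
        also have "\<dots> = real (((n - 1) choose m) * fact m) * exp (real m)" by simp
        also have "\<dots> \<le> real (n ^ m) * exp (real m)"
        proof (intro mult_right_mono)
          have "((n - 1) choose m) * fact m \<le> (n - 1) ^ m" by (rule binomial_fact_pow)
          also have "\<dots> \<le> n ^ m" by (intro power_mono) auto
          finally show "real (((n - 1) choose m) * fact m) \<le> real (n ^ m)" by (simp only: of_nat_le_iff)
        qed simp
        also have "\<dots> = (exp 1 * real n) ^ m"
          by (simp add: power_mult_distrib flip: exp_of_nat_mult)
        finally have "real ((n - 1) choose m) * real (m + 1) ^ m * (lam\<^sup>2 * rho\<^sup>2) ^ m \<le> (exp 1 * real n) ^ m * (lam\<^sup>2 * rho\<^sup>2) ^ m"
          by (rule mult_right_mono) simp
        also have "\<dots> = (lam\<^sup>2 * (exp 1 * rho\<^sup>2 * real n)) ^ m"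
          by (simp add: power_mult_distrib mult_ac)
        also have "\<dots> \<le> r ^ m"
        proof (rule power_mono)
          show "lam\<^sup>2 * (exp 1 * rho\<^sup>2 * real n) \<le> r"
            using assms(8) assms(1,2) by (simp add: pos_le_divide_eq)
        qed simp
        finally show "real ((n - 1) choose m) * real (m + 1) ^ m * (lam\<^sup>2 * rho\<^sup>2) ^ m \<le> r ^ m" .
        show "((real (m + 1))\<^sup>2 * lam\<^sup>2) ^ l \<le> (1 / 3) ^ l"
        \<comment> \<open>Only an excess edge yields m + 1 \<le> D. For l = 0 the case m = D does
          occur, but the power is then 1.\<close>
        proof (cases "l = 0")
          case False
          have "(real (m + 1))\<^sup>2 * lam\<^sup>2 \<le> (exp 1 / 3 * r * rho\<^sup>2 * real n) * (r / (exp 1 * rho\<^sup>2 * real n))"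
          proof (rule mult_mono)
            have "(real (m + 1))\<^sup>2 \<le> (real D)\<^sup>2" using False True by (intro power_mono) auto
            then show "(real (m + 1))\<^sup>2 \<le> exp 1 / 3 * r * rho\<^sup>2 * real n" using assms(9) by linarith
          qed (use assms in auto)
          also have "\<dots> = r * r / 3" using assms by (simp add: field_simps)
          also have "\<dots> \<le> 1 / 3" using assms mult_mono[of r 1 r 1] by simp
          finally show ?thesis by (intro power_mono) auto
        qed simp
      qed (use assms in auto)
      finally show ?thesis .
    qed
    finally show "(\<Sum>\<alpha>\<in>{\<alpha>\<in>G. g \<alpha> = q}. ?w (fst (g \<alpha>)) (snd (g \<alpha>))) \<le> rho\<^sup>2 * (r ^ fst q * (1 / 3) ^ snd q)"
      by (simp add: q)
  qed
  also have "\<dots> = rho\<^sup>2 * ((\<Sum>m\<le>D. r ^ m) * (\<Sum>l\<le>D. (1 / 3) ^ l))"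
    by (simp only: sum_product sum.cartesian_product) (simp add: sum_distrib_left case_prod_unfold)
  also have "\<dots> \<le> rho\<^sup>2 * ((1 / (1 - r)) * (1 / (1 - 1 / 3)))"
    using assms by (intro mult_left_mono mult_mono sum_power_le_inverse) (auto intro: sum_nonneg)
  \<comment> \<open>The series over excess edges sums to 3/2, and 1 - r \<le> 1 allows a second
    factor 1/(1 - r).\<close>
  also have "\<dots> \<le> rho\<^sup>2 * (2 / (1 - r)\<^sup>2)"
  proof (rule mult_left_mono)
    have "1 / (1 - r) \<le> 1 / (1 - r)\<^sup>2"
      using assms by (simp add: frac_le power2_eq_square mult_le_one)
    moreover have "0 \<le> 1 / (1 - r)\<^sup>2" by simp
    moreover have "1 / (1 - r) * (1 / (1 - 1 / 3)) = 3 / 2 * (1 / (1 - r))" "2 / (1 - r)\<^sup>2 = 2 * (1 / (1 - r)\<^sup>2)"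
      by simp_all
    ultimately show "1 / (1 - r) * (1 / (1 - 1 / 3)) \<le> 2 / (1 - r)\<^sup>2" by linarith
  qed simp
  finally show ?thesis by (simp add: mult.commute)
qed

section \<open>Counting trees\<close>

text \<open>Iterating f hits R after finitely many steps. The least fixed point excludes cycles, so
  a parent function all of whose points reach R is a forest rooted in R.\<close>

inductive reaches :: "(nat \<Rightarrow> nat) \<Rightarrow> nat set \<Rightarrow> nat \<Rightarrow> bool" for f R where
  root: "v \<in> R \<Longrightarrow> reaches f R v"
| step: "reaches f R (f v) \<Longrightarrow> reaches f R v"

definition forests :: "nat set \<Rightarrow> nat set \<Rightarrow> (nat \<Rightarrow> nat) set" where
  "forests A R = {f \<in> A \<rightarrow>\<^sub>E A \<union> R. \<forall>v\<in>A. reaches f R v}"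

lemma finite_forests: "finite A \<Longrightarrow> finite R \<Longrightarrow> finite (forests A R)"
  unfolding forests_def by (rule finite_subset[of _ "A \<rightarrow>\<^sub>E A \<union> R"]) (auto intro: finite_PiE)

text \<open>A forest is built from the set \<open>B\<close> of children of the roots, their attachment to \<open>R\<close>,
  and a forest on the remaining vertices with root set \<open>B\<close>.\<close>
lemma card_forests_layer:
  assumes "finite A" "finite R" "A \<inter> R = {}"
  shows "(\<Sum>B\<in>Pow A. card R ^ card B * card (forests (A - B) B)) \<le> card (forests A R)"
proof -
  define Dom where "Dom = (SIGMA B:Pow A. (B \<rightarrow>\<^sub>E R) \<times> forests (A - B) B)"
  define glue where "glue = (\<lambda>(B, g, h) v::nat. if v \<in> B then g v else h v :: nat)"
  have fin: "finite B" if "B \<in> Pow A" for B using that assms(1) finite_subset by blast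
  have "card Dom = (\<Sum>B\<in>Pow A. card R ^ card B * card (forests (A - B) B))"
    unfolding Dom_def
    using assms fin by (subst card_SigmaI)
      (auto simp: card_cartesian_product card_PiE intro!: finite_PiE finite_forests sum.cong)
  moreover have "inj_on glue Dom"
  proof (rule inj_onI)
    fix x y assume x: "x \<in> Dom" and y: "y \<in> Dom" and eq: "glue x = glue y"
    obtain B g h B' g' h' where xy: "x = (B, g, h)" "y = (B', g', h')" by (metis prod_cases3)
    have B: "B \<subseteq> A" "g \<in> B \<rightarrow>\<^sub>E R" "h \<in> (A - B) \<rightarrow>\<^sub>E A"
      using x by (auto simp: xy Dom_def forests_def Un_absorb1 Un_commute)
    have B': "B' \<subseteq> A" "g' \<in> B' \<rightarrow>\<^sub>E R" "h' \<in> (A - B') \<rightarrow>\<^sub>E A"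
      using y by (auto simp: xy Dom_def forests_def Un_absorb1 Un_commute)
    have eqv: "(if v \<in> B then g v else h v) = (if v \<in> B' then g' v else h' v)" for v
      using fun_cong[OF eq, of v] by (simp add: xy glue_def)
    \<comment> \<open>The layer B is recovered from the glued function as the set of points sent
      into R, since h takes its values in A, which is disjoint from R.\<close>
    have mem: "v \<in> B \<longleftrightarrow> v \<in> B'" if v: "v \<in> A" for v
    proof -
      have "v \<in> B \<longleftrightarrow> (if v \<in> B then g v else h v) \<in> R"
        using B(2,3) v assms(3) by (auto dest!: PiE_mem)
      moreover have "v \<in> B' \<longleftrightarrow> (if v \<in> B' then g' v else h' v) \<in> R"
        using B'(2,3) v assms(3) by (auto dest!: PiE_mem)
      ultimately show ?thesis using eqv by simp
    qed
    have BB: "B = B'" using mem B(1) B'(1) by blast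
    have "g = g'" using B(2) B'(2) eqv unfolding BB by (metis PiE_ext)
    moreover have "h = h'"
    proof (rule PiE_ext[OF B(3)])
      show "h' \<in> (A - B) \<rightarrow>\<^sub>E A" using B'(3) by (simp add: BB)
      fix v assume "v \<in> A - B"
      then show "h v = h' v" using eqv[of v] by (simp add: BB)
    qed
    ultimately show "x = y" by (simp add: xy BB)
  qed
  moreover have "glue ` Dom \<subseteq> forests A R"
  proof safe
    fix B g h assume "(B, g, h) \<in> Dom"
    then have B: "B \<subseteq> A" "g \<in> B \<rightarrow>\<^sub>E R" "h \<in> (A - B) \<rightarrow>\<^sub>E A" "\<forall>v\<in>A - B. reaches h B v"
      by (auto simp: Dom_def forests_def Un_absorb1 Un_commute)
    define f where "f = glue (B, g, h)"
    have f: "f v = (if v \<in> B then g v else h v)" for v by (simp add: f_def glue_def)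
    have fB: "reaches f R v" if "v \<in> B" for v
      using that B(2) f[of v] by (intro reaches.step[of f R v] reaches.root) auto
    \<comment> \<open>The guard is there because the rules of \<open>reaches\<close> also speak of
      points outside A, where h is \<open>undefined\<close>.\<close>
    have "v \<in> A \<longrightarrow> reaches f R v" if "reaches h B v" for v
      using that
    proof induction
      case (root v)
      then show ?case using fB by blast
    next
      case (step v)
      show ?case
      proof
        assume v: "v \<in> A"
        show "reaches f R v"
        proof (cases "v \<in> B")
          case False
          then have "h v \<in> A" using B(3) v by auto
          then have "reaches f R (h v)" using step.IH by blast
          then show ?thesis using False f[of v] by (intro reaches.step[of f R v]) simp
        qed (rule fB)
      qed
    qed
    then have "\<forall>v\<in>A. reaches f R v" using B(4) fB by blast
    moreover have "f \<in> A \<rightarrow>\<^sub>E A \<union> R"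
    proof (rule PiE_I)
      show "f v \<in> A \<union> R" if "v \<in> A" for v using that B(2,3) by (auto simp: f)
      show "f v = undefined" if "v \<notin> A" for v
        using that B(1) PiE_arb[OF B(3), of v] by (auto simp: f)
    qed
    ultimately show "glue (B, g, h) \<in> forests A R" by (simp add: forests_def f_def)
  qed
  ultimately show ?thesis
    using card_inj_on_le[of glue Dom "forests A R"] finite_forests[OF assms(1,2)] by simp
qed

lemma sum_Pow_card:
  fixes h :: "nat \<Rightarrow> nat"
  assumes "finite A"
  shows "(\<Sum>B\<in>Pow A. h (card B)) = (\<Sum>b\<le>card A. (card A choose b) * h b)"
proof -
  have "(\<Sum>B\<in>Pow A. h (card B)) = (\<Sum>b\<in>{..card A}. \<Sum>B\<in>{B \<in> Pow A. card B = b}. h (card B))"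
    by (rule sum.group[symmetric]) (use assms in \<open>auto intro: card_mono\<close>)
  also have "\<dots> = (\<Sum>b\<in>{..card A}. (card A choose b) * h b)"
  proof (intro sum.cong refl)
    fix b
    have "{B \<in> Pow A. card B = b} = {B. B \<subseteq> A \<and> card B = b}" by auto
    then show "(\<Sum>B\<in>{B \<in> Pow A. card B = b}. h (card B)) = (card A choose b) * h b"
      using n_subsets[OF assms, of b] by simp
  qed
  finally show ?thesis .
qed

text \<open>Absorption, b binom(k+1, b) = (k+1) binom(k, b-1), reduces this to the binomial theorem.
  It evaluates the sum over layers in Cayley's recursion.\<close>

lemma sum_binomial_weighted:
  fixes s a :: nat
  shows "(\<Sum>b\<le>Suc k. (Suc k choose b) * (s ^ b * (b * a ^ (Suc k - b)))) = Suc k * s * (s + a) ^ k"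
proof -
  have "(\<Sum>b\<le>Suc k. (Suc k choose b) * (s ^ b * (b * a ^ (Suc k - b)))) =
    (\<Sum>b\<le>k. (Suc b * (Suc k choose Suc b)) * (s ^ Suc b * a ^ (k - b)))"
    by (subst sum.atMost_Suc_shift) (simp add: mult_ac del: binomial_Suc_Suc mult_Suc mult_Suc_right)
  also have "\<dots> = (\<Sum>b\<le>k. (Suc k * s) * ((k choose b) * s ^ b * a ^ (k - b)))"
    unfolding Suc_times_binomial by (intro sum.cong refl) (simp add: algebra_simps)
  also have "\<dots> = Suc k * s * (s + a) ^ k"
    by (simp add: binomial flip: sum_distrib_left)
  finally show ?thesis .
qed

text \<open>Cayley's formula for rooted forests (lower bound), multiplied by \<open>card A + card R\<close> to
  avoid the exponent \<open>card A - 1\<close> for empty \<open>A\<close>.\<close>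
lemma card_forests_ge:
  assumes "finite A" "finite R" "A \<inter> R = {}"
  shows "card R * (card A + card R) ^ card A \<le> (card A + card R) * card (forests A R)"
  using assms
proof (induction "card A" arbitrary: A R rule: less_induct)
  case less
  show ?case
  proof (cases "card A")
    case 0
    then have "A = {}" using less.prems by simp
    then have "forests A R = {\<lambda>x. undefined}" by (auto simp: forests_def)
    then show ?thesis using 0 by simp
  next
    case (Suc k)
    let ?a = "card A" and ?s = "card R"
    \<comment> \<open>For A - B with roots B the total number of vertices is again |A|, so the
      induction hypothesis has the form |B| |A|^(|A|-|B|) \<le> |A| times the number of forests.
      This explains the extra factor |A| carried through the chain.\<close>
    have "?a * ?s * (?s + ?a) ^ k = (\<Sum>B\<in>Pow A. ?s ^ card B * (card B * ?a ^ (?a - card B)))"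
      using sum_Pow_card[OF less.prems(1), of "\<lambda>b. ?s ^ b * (b * ?a ^ (?a - b))"]
        sum_binomial_weighted[of k ?s ?a] Suc by simp
    also have "\<dots> \<le> (\<Sum>B\<in>Pow A. ?s ^ card B * (?a * card (forests (A - B) B)))"
    proof (rule sum_mono)
      fix B assume "B \<in> Pow A"
      then have B: "B \<subseteq> A" "finite B" using less.prems(1) finite_subset by auto
      show "?s ^ card B * (card B * ?a ^ (?a - card B)) \<le> ?s ^ card B * (?a * card (forests (A - B) B))"
      proof (cases "B = {}")
        case False
        then have "0 < card B" using B by (simp add: card_gt_0_iff)
        moreover have "card (A - B) = ?a - card B" "card B \<le> ?a"
          using B less.prems(1) by (auto simp: card_Diff_subset card_mono)
        ultimately have "card B * ?a ^ (?a - card B) \<le> ?a * card (forests (A - B) B)"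
          using less.hyps[of "A - B" B] B less.prems(1) Suc by auto
        then show ?thesis by simp
      qed simp
    qed
    also have "\<dots> = ?a * (\<Sum>B\<in>Pow A. ?s ^ card B * card (forests (A - B) B))"
      by (simp add: sum_distrib_left mult_ac)
    also have "\<dots> \<le> ?a * card (forests A R)"
      using card_forests_layer[OF less.prems] by (rule mult_le_mono2)
    finally have "?s * (?s + ?a) ^ k \<le> card (forests A R)"
      by (simp only: mult.assoc mult_le_cancel1) (simp only: Suc zero_less_Suc simp_thms)
    then have "(?a + ?s) * (?s * (?s + ?a) ^ k) \<le> (?a + ?s) * card (forests A R)"
      by (rule mult_le_mono2)
    then show ?thesis by (simp add: Suc add.commute mult_ac)
  qed
qed

text \<open>Cayley's number for k + 2 vertices: a single root contributes the factor 1, and one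
  factor k + 2 cancels.\<close>

lemma card_rooted_trees_ge:
  assumes "finite A" "0 \<notin> A" "card A = Suc k"
  shows "(k + 2) ^ k \<le> card (forests A {0})"
proof -
  have "(k + 2) * (k + 2) ^ k \<le> (k + 2) * card (forests A {0})"
    using card_forests_ge[of A "{0}"] assms by simp
  then show ?thesis by (simp only: mult_le_cancel1)
qed

text \<open>A 2-cycle through v is also one through \<open>f v\<close>, so it would propagate along
  the path to a root; roots lie outside A.\<close>

lemma reaches_no_2_cycle:
  assumes "reaches f R v" "A \<inter> R = {}" "v \<in> A" "f v \<in> A"
  shows "f (f v) \<noteq> v"
  using assms
proof (induction rule: reaches.induct)
  case (step v)
  show ?case
  proof
    assume "f (f v) = v"
    then show False using step by simp
  qed
qed auto

lemma forests_edge_inj: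
  assumes "f \<in> forests A R" "A \<inter> R = {}"
  shows "inj_on (\<lambda>v. edge v (f v)) A"
proof (rule inj_onI)
  fix v w assume vw: "v \<in> A" "w \<in> A" "edge v (f v) = edge w (f w)"
  have "\<not> (v = f w \<and> f v = w)"
    using reaches_no_2_cycle[of f R v A] assms vw(1,2) by (auto simp: forests_def)
  then show "v = w" using vw(3) by (auto simp: edge_eq_iff)
qed

text \<open>Induction along the path to the root. If f and g differ at v, the edge from v to
  \<open>f v\<close> must be the g-edge of \<open>f v\<close>, so g sends \<open>f v\<close> back to
  v. By induction f does so too, a 2-cycle.\<close>

lemma parent_graph_eqD:
  assumes "f \<in> forests A R" "g \<in> forests A R" "A \<inter> R = {}" "parent_graph A f = parent_graph A g"
  shows "f = g"
proof (rule PiE_ext)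
  show "f \<in> A \<rightarrow>\<^sub>E A \<union> R" "g \<in> A \<rightarrow>\<^sub>E A \<union> R" using assms by (auto simp: forests_def)
  have "v \<in> A \<longrightarrow> f v = g v" if "reaches f R v" for v
    using that
  proof induction
    case (root v)
    then show ?case using assms(3) by blast
  next
    case (step v)
    show ?case
    proof
      assume v: "v \<in> A"
      then have "parent_graph A f (edge v (f v)) = 1" by (auto simp: parent_graph_def)
      then have "parent_graph A g (edge v (f v)) = 1" using assms(4) by simp
      then obtain w where w: "w \<in> A" "edge v (f v) = edge w (g w)"
        by (auto simp: parent_graph_def of_bool_def split: if_splits)
      show "f v = g v"
      proof (rule ccontr)
        assume "f v \<noteq> g v"
        then have "f v = w" "g w = v" using w(2) by (auto simp: edge_eq_iff)
        then have "f (f v) = v" "f v \<in> A" using step.IH w(1) by auto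
        moreover have "reaches f R v" using step.hyps by (rule reaches.step)
        ultimately show False using reaches_no_2_cycle[OF _ assms(3) v] by blast
      qed
    qed
  qed
  then show "f v = g v" if "v \<in> A" for v using assms(1) that by (auto simp: forests_def)
qed

lemma verts_parent_graph: "verts (parent_graph A f) = A \<union> f ` A"
proof -
  have "{p. parent_graph A f p \<noteq> 0} = (\<lambda>v. edge v (f v)) ` A"
    by (auto simp: parent_graph_def)
  moreover have "{fst (edge v w), snd (edge v w)} = {v, w}" for v w
    by (auto simp: edge_def min_def max_def)
  ultimately show ?thesis unfolding verts_def by auto
qed

text \<open>For attachedness: membership in a set closed under edges is constant along parent steps,
  so every vertex shares the status of the root 0, which is outside. The factorial is 1 because the
  graph is simple.\<close>

lemma rooted_tree_properties:
  assumes "f \<in> forests A {0}" "A \<subseteq> {1..<n}" "A \<noteq> {}"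
  shows "parent_graph A f \<in> msupp n" "mdeg n (parent_graph A f) = card A"
    "insert 0 (verts (parent_graph A f)) = insert 0 A" "\<not> detached (parent_graph A f)"
    "mfact n (parent_graph A f) = 1"
proof -
  have f: "f v \<in> insert 0 A" "reaches f {0} v" if "v \<in> A" for v
    using assms(1) that by (auto simp: forests_def)
  have e: "edge v (f v) \<in> Idx n" if "v \<in> A" for v
    using that f(1)[OF that] assms(2) by auto
  show "parent_graph A f \<in> msupp n"
    unfolding msupp_def parent_graph_def using e by auto
  show "mdeg n (parent_graph A f) = card A"
    using assms by (intro mdeg_parent_graph forests_edge_inj[of _ _ "{0}"] e) auto
  show "insert 0 (verts (parent_graph A f)) = insert 0 A"
    using f(1) by (auto simp: verts_parent_graph)
  show "mfact n (parent_graph A f) = 1"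
    unfolding mfact_def by (intro prod.neutral) (auto simp: parent_graph_def)
  show "\<not> detached (parent_graph A f)"
  proof
    assume "detached (parent_graph A f)"
    then obtain S p where S: "0 \<notin> S" "\<forall>p. parent_graph A f p \<noteq> 0 \<longrightarrow> (fst p \<in> S \<longleftrightarrow> snd p \<in> S)"
      and p: "parent_graph A f p \<noteq> 0" "fst p \<in> S" unfolding detached_def by metis
    have iff: "v \<in> S \<longleftrightarrow> f v \<in> S" if "v \<in> A" for v
    proof -
      have "parent_graph A f (edge v (f v)) \<noteq> 0" using that by (auto simp: parent_graph_def)
      then have "fst (edge v (f v)) \<in> S \<longleftrightarrow> snd (edge v (f v)) \<in> S" using S(2) by metis
      then show ?thesis by (auto simp: edge_def min_def max_def split: if_splits)
    qed
    have "v \<in> A \<longrightarrow> v \<notin> S" if "reaches f {0} v" for v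
      using that
    proof induction
      case (step v)
      then show ?case using iff[of v] f(1)[of v] S(1) by auto
    qed (use S(1) in auto)
    then have "v \<notin> S" if "v \<in> insert 0 A" for v using that f(2)[of v] S(1) by blast
    moreover have "fst p \<in> insert 0 A"
    proof -
      have "f ` A \<subseteq> insert 0 A" by (intro image_subsetI f(1))
      then show ?thesis
        using fst_in_verts[of "parent_graph A f" p, OF p(1)] unfolding verts_parent_graph by blast
    qed
    ultimately show False using p(2) by blast
  qed
qed

section \<open>Factorial estimates for the tree count\<close>

lemma fact_mult_power_le: "(m + 1) ^ k * fact m \<le> (fact (m + k) :: nat)"
proof (induction k)
  case (Suc k)
  have "(m + 1) ^ Suc k * fact m = (m + 1) * ((m + 1) ^ k * fact m)" by (simp only: power_Suc mult.assoc)
  also have "\<dots> \<le> (m + Suc k) * fact (m + k)" using Suc by (intro mult_mono) auto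
  finally show ?case by simp
qed simp

text \<open>The right side is the falling product (n-1)...(n-D), all of whose factors are at least n
  - D.\<close>

lemma binomial_fact_ge:
  assumes "D < n"
  shows "(n - D) ^ D \<le> ((n - 1) choose D) * fact D"
proof -
  have "(n - D) ^ D * fact (n - 1 - D) \<le> fact (n - 1)"
    using fact_mult_power_le[of "n - 1 - D" D] assms by (simp add: Suc_diff_Suc)
  also have "\<dots> = ((n - 1) choose D) * fact D * fact (n - 1 - D)"
    using binomial_fact_lemma[of D "n - 1"] assms by (simp add: mult_ac)
  finally show ?thesis by simp
qed

text \<open>A Pade bound: the difference vanishes at 0 and has derivative y^2 / ((1+y)(2+y)^2). It
  is sharp enough to give the exponent 3/2 in the Stirling-type bound below.\<close>

lemma ln_one_plus_ge:
  fixes x :: real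
  assumes "0 \<le> x"
  shows "2 * x / (2 + x) \<le> ln (1 + x)"
proof -
  define h where "h = (\<lambda>x::real. ln (1 + x) - 2 * x / (2 + x))"
  have "h 0 \<le> h x"
  proof (rule DERIV_nonneg_imp_nondecreasing[OF assms])
    fix y :: real assume y: "0 \<le> y" "y \<le> x"
    have "(h has_real_derivative (1 / (1 + y) - (2 * (2 + y) - 2 * y) / (2 + y)\<^sup>2)) (at y)"
      unfolding h_def using y by (auto intro!: derivative_eq_intros simp: power2_eq_square)
    moreover have "1 / (1 + y) - (2 * (2 + y) - 2 * y) / (2 + y)\<^sup>2 = y\<^sup>2 / ((1 + y) * (2 + y)\<^sup>2)"
      using y by (simp add: divide_simps power2_eq_square) (simp add: algebra_simps)
    moreover have "0 \<le> y\<^sup>2 / ((1 + y) * (2 + y)\<^sup>2)" using y by simp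
    ultimately show "\<exists>d. (h has_real_derivative d) (at y) \<and> 0 \<le> d" by metis
  qed
  then show ?thesis by (simp add: h_def)
qed

text \<open>A Stirling-type bound: each increment of \<open>k\<close> multiplies the right side by at least
  \<open>exp 1 * (k + 2)\<close>.\<close>
lemma exp_fact_le: "exp (real k) * fact (k + 1) \<le> real (k + 2) ^ k * real (k + 1) powr (3/2)"
proof (induction k)
  case (Suc k)
  \<comment> \<open>The logarithm of the increment inequality after the Pade bound. The exponent 3/2
    enters through 2(k+1) + 3 = 2k + 5.\<close>
  have "1 \<le> real (k + 1) * (2 / (2 * real k + 5)) + 3 / 2 * (2 / (2 * real k + 3))"
  proof -
    have "3 / (2 * real k + 5) \<le> 3 / (2 * real k + 3)" by (intro divide_left_mono) auto
    moreover have "real (k + 1) * (2 / (2 * real k + 5)) + 3 / (2 * real k + 5) = 1"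
    proof -
      have "real (k + 1) * 2 + 3 = 2 * real k + 5" "0 < 2 * real k + 5" by simp_all
      then show ?thesis by (simp only: times_divide_eq_right add_divide_distrib[symmetric]) simp
    qed
    ultimately show ?thesis by simp
  qed
  also have "\<dots> \<le> real (k + 1) * ln (1 + 1 / real (k + 2)) + 3 / 2 * ln (1 + 1 / real (k + 1))"
  proof (intro add_mono mult_left_mono)
    have "2 * (1 / real (k + 2)) / (2 + 1 / real (k + 2)) = 2 / (2 * real k + 5)"
      by (simp add: divide_simps) (simp add: algebra_simps)
    then show "2 / (2 * real k + 5) \<le> ln (1 + 1 / real (k + 2))"
      using ln_one_plus_ge[of "1 / real (k + 2)"] by simp
    have "2 * (1 / real (k + 1)) / (2 + 1 / real (k + 1)) = 2 / (2 * real k + 3)"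
      by (simp add: divide_simps) (simp add: algebra_simps)
    then show "2 / (2 * real k + 3) \<le> ln (1 + 1 / real (k + 1))"
      using ln_one_plus_ge[of "1 / real (k + 1)"] by simp
  qed auto
  finally have "exp 1 \<le> exp (real (k + 1) * ln (1 + 1 / real (k + 2)) + 3 / 2 * ln (1 + 1 / real (k + 1)))"
    by simp
  also have "\<dots> = (1 + 1 / real (k + 2)) ^ (k + 1) * (1 + 1 / real (k + 1)) powr (3/2)"
  proof -
    have "0 < 1 + 1 / real (k + 1)" "0 < 1 + 1 / real (k + 2)" by (simp_all add: add_pos_pos)
    then show ?thesis
      unfolding exp_add exp_of_nat_mult by (simp add: powr_def)
  qed
  finally have e: "exp 1 \<le> (1 + 1 / real (k + 2)) ^ (k + 1) * (1 + 1 / real (k + 1)) powr (3/2)" .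
  have "exp (real (Suc k)) * fact (Suc k + 1) = exp 1 * real (k + 2) * (exp (real k) * fact (k + 1))"
    by (simp add: exp_add mult_ac)
  also have "\<dots> \<le> exp 1 * real (k + 2) * (real (k + 2) ^ k * real (k + 1) powr (3/2))"
    using Suc.IH by (intro mult_left_mono) auto
  also have "\<dots> = exp 1 * (real (k + 2) ^ (k + 1) * real (k + 1) powr (3/2))"
    by simp
  also have "\<dots> \<le> ((1 + 1 / real (k + 2)) ^ (k + 1) * (1 + 1 / real (k + 1)) powr (3/2)) *
      (real (k + 2) ^ (k + 1) * real (k + 1) powr (3/2))"
    by (rule mult_right_mono[OF e]) simp
  also have "\<dots> = ((1 + 1 / real (k + 2)) * real (k + 2)) ^ (k + 1) *
      ((1 + 1 / real (k + 1)) * real (k + 1)) powr (3/2)"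
    by (simp only: power_mult_distrib) (simp add: powr_mult mult_ac)
  also have "(1 + 1 / real (k + 2)) * real (k + 2) = real (Suc k + 2)" by (simp add: field_simps)
  also have "(1 + 1 / real (k + 1)) * real (k + 1) = real (Suc k + 1)" by (simp add: field_simps)
  finally show ?case by simp
qed simp

text \<open>Each tree with D edges has \<alpha>! = 1 and weight at least \<open>w\<close>, the
  square of half the leading term. There are at least binom(n-1, D) (D+1)^(D-1) of them, and with k
  = D - 1 the Stirling-type bound produces e^(D-1).\<close>

lemma sum_kappa_lower:
  assumes "0 < rho" "rho < 1" "0 \<le> lam" "2 ^ D * rho \<le> 1 / 2" "1 \<le> D" "D < n"
  shows "rho\<^sup>2 / (4 * exp 1 * real D powr (3/2)) * (exp 1 * lam\<^sup>2 * rho\<^sup>2 * (real n - real D)) ^ D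
    \<le> (\<Sum>\<alpha>\<in>Mons n D. (kappa n rho lam \<alpha>)\<^sup>2 / mfact n \<alpha>)"
proof -
  define w where "w = (lam ^ D * rho ^ (D + 1) / 2)\<^sup>2"
  define Dom where "Dom = (SIGMA A:{A. A \<subseteq> {1..<n} \<and> card A = D}. forests A {0})"
  define gr where "gr = (\<lambda>(A, f). parent_graph A f)"
  obtain k where k: "D = Suc k" using assms(5) by (cases D) auto
  have fin: "finite A" if "A \<subseteq> {1..<n}" for A using that finite_subset by blast
  have finA: "finite {A. A \<subseteq> {1..<n} \<and> card A = D}" by (rule finite_subset[of _ "Pow {1..<n}"]) auto
  have finDom: "finite Dom" unfolding Dom_def using finA fin by (intro finite_SigmaI finite_forests) auto
  have props: "gr x \<in> msupp n" "mdeg n (gr x) = D" "insert 0 (verts (gr x)) = insert 0 (fst x)"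
    "\<not> detached (gr x)" "mfact n (gr x) = 1" "card (insert 0 (fst x)) = D + 1" if "x \<in> Dom" for x
  proof -
    obtain A f where x: "x = (A, f)" by (cases x)
    have A: "A \<subseteq> {1..<n}" "card A = D" "f \<in> forests A {0}" using that by (auto simp: x Dom_def)
    then have "A \<noteq> {}" using assms(5) by auto
    note * = rooted_tree_properties[OF A(3,1) this]
    show "gr x \<in> msupp n" "mdeg n (gr x) = D" "insert 0 (verts (gr x)) = insert 0 (fst x)"
      "\<not> detached (gr x)" "mfact n (gr x) = 1"
      using * A(2) by (simp_all add: x gr_def)
    show "card (insert 0 (fst x)) = D + 1" using A fin[OF A(1)] by (auto simp: x card_insert_if)
  qed
  have inj: "inj_on gr Dom"
  proof (rule inj_onI)
    fix x y assume x: "x \<in> Dom" and y: "y \<in> Dom" and eq: "gr x = gr y"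
    obtain A f B g where xy: "x = (A, f)" "y = (B, g)" by (metis prod.exhaust)
    have A: "A \<subseteq> {1..<n}" "f \<in> forests A {0}" and B: "B \<subseteq> {1..<n}" "g \<in> forests B {0}"
      using x y by (auto simp: xy Dom_def)
    \<comment> \<open>The graph determines its non-root vertices, so trees on different sets A never
      coincide.\<close>
    have "insert 0 A = insert 0 B" using props(3)[OF x] props(3)[OF y] eq by (simp add: xy)
    moreover have "0 \<notin> A" "0 \<notin> B" using A B by auto
    ultimately have AB: "A = B" by (metis Diff_insert_absorb)
    have "f = g" by (rule parent_graph_eqD[of _ A "{0}"])
      (use A B eq \<open>0 \<notin> A\<close> in \<open>auto simp: AB xy gr_def\<close>)
    then show "x = y" by (simp add: xy AB)
  qed
  have "((n - 1) choose D) * (k + 2) ^ k = (\<Sum>A\<in>{A. A \<subseteq> {1..<n} \<and> card A = D}. (k + 2) ^ k)"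
    using n_subsets[of "{1..<n}" D] by simp
  also have "\<dots> \<le> (\<Sum>A\<in>{A. A \<subseteq> {1..<n} \<and> card A = D}. card (forests A {0}))"
    using k fin by (intro sum_mono card_rooted_trees_ge) auto
  also have "\<dots> = card Dom"
    unfolding Dom_def using finA fin by (subst card_SigmaI) (auto intro!: finite_forests)
  finally have cardDom: "((n - 1) choose D) * (k + 2) ^ k \<le> card Dom" .
  have num: "exp (real k) * (real n - real D) ^ D \<le> real (card Dom) * real D powr (3/2)"
  proof -
    have "(real n - real D) ^ D = real ((n - D) ^ D)" using assms(6) by simp
    also have "\<dots> \<le> real (((n - 1) choose D) * fact D)"
      using binomial_fact_ge[OF assms(6)] by (simp only: of_nat_le_iff)
    finally have "exp (real k) * (real n - real D) ^ D \<le> exp (real k) * real (((n - 1) choose D) * fact D)"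
      by (rule mult_left_mono) simp
    also have "\<dots> = real ((n - 1) choose D) * (exp (real k) * fact (k + 1))"
      by (simp only: k of_nat_mult of_nat_fact Suc_eq_plus1 mult_ac)
    also have "\<dots> \<le> real ((n - 1) choose D) * (real (k + 2) ^ k * real (k + 1) powr (3/2))"
      by (intro mult_left_mono exp_fact_le) simp
    also have "\<dots> = real (((n - 1) choose D) * (k + 2) ^ k) * real D powr (3/2)"
      by (simp add: k)
    also have "\<dots> \<le> real (card Dom) * real D powr (3/2)"
      using cardDom by (intro mult_right_mono) (simp_all only: of_nat_le_iff powr_ge_zero)
    finally show ?thesis .
  qed
  have "rho\<^sup>2 / (4 * exp 1 * real D powr (3/2)) * (exp 1 * lam\<^sup>2 * rho\<^sup>2 * (real n - real D)) ^ D
      = w * (exp (real k) * (real n - real D) ^ D) / real D powr (3/2)"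
  proof -
    have "exp 1 ^ D = exp 1 * exp (real k)" by (simp add: k exp_of_nat_mult[symmetric] flip: exp_add)
    then show ?thesis
      by (simp add: w_def power_mult_distrib power_divide power2_eq_square mult_ac)
  qed
  also have "\<dots> \<le> w * (real (card Dom) * real D powr (3/2)) / real D powr (3/2)"
    using num by (intro divide_right_mono mult_left_mono) (auto simp: w_def)
  also have "\<dots> = (\<Sum>x\<in>Dom. w)" using assms(5) by simp
  also have "\<dots> \<le> (\<Sum>x\<in>Dom. (kappa n rho lam (gr x))\<^sup>2 / mfact n (gr x))"
  proof (rule sum_mono)
    fix x assume x: "x \<in> Dom"
    have "lam ^ D * rho ^ (D + 1) / 2 \<le> kappa n rho lam (gr x)"
      using kappa_bounds[OF _ assms(1-4) props(1)[OF x]] props(2-4,6)[OF x] assms(6) by auto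
    then have "w \<le> (kappa n rho lam (gr x))\<^sup>2"
      unfolding w_def using assms by (intro power_mono) auto
    then show "w \<le> (kappa n rho lam (gr x))\<^sup>2 / mfact n (gr x)" by (simp add: props(5)[OF x])
  qed
  also have "\<dots> = (\<Sum>\<alpha>\<in>gr ` Dom. (kappa n rho lam \<alpha>)\<^sup>2 / mfact n \<alpha>)"
    by (simp add: sum.reindex[OF inj])
  also have "\<dots> \<le> (\<Sum>\<alpha>\<in>Mons n D. (kappa n rho lam \<alpha>)\<^sup>2 / mfact n \<alpha>)"
  proof (rule sum_mono2)
    show "gr ` Dom \<subseteq> Mons n D" using props(1,2) by (auto simp: Mons_eq)
    show "0 \<le> (kappa n rho lam \<alpha>)\<^sup>2 / mfact n \<alpha>" for \<alpha>
      using mfact_ge_1[of n \<alpha>] by simp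
  qed simp
  finally show ?thesis .
qed

section \<open>Gaussian duality\<close>

definition gauss :: "real \<Rightarrow> real measure" where
  "gauss s = density lborel (normal_density 0 (sqrt s))"

text \<open>A functional on formal polynomials, so that the Hermite calculus becomes algebra with
  \<open>pderiv\<close> and \<open>pcompose\<close>, free of integrability side conditions.\<close>

definition gauss_mean :: "real \<Rightarrow> real poly \<Rightarrow> real" where
  "gauss_mean s q = (\<integral>x. poly q x \<partial>gauss s)"

text \<open>Hermite polynomials orthogonal for the centered Gaussian of variance \<open>s\<close>.\<close>
fun herm :: "real \<Rightarrow> nat \<Rightarrow> real poly" where
  "herm s 0 = 1"
| "herm s (Suc k) = pCons 0 (herm s k) - smult s (pderiv (herm s k))"

lemma prob_space_gauss: "0 < s \<Longrightarrow> prob_space (gauss s)"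
  unfolding gauss_def by (rule prob_space_normal_density) simp

lemma sets_gauss [simp, measurable_cong]: "sets (gauss s) = sets borel"
  by (simp add: gauss_def)

lemma integrable_gauss_power: "0 < s \<Longrightarrow> integrable (gauss s) (\<lambda>x. x ^ k)"
  unfolding gauss_def using integrable_normal_moment[of "sqrt s" 0 k]
  by (subst integrable_density) auto

lemma integrable_gauss_poly: "0 < s \<Longrightarrow> integrable (gauss s) (\<lambda>x. poly q x)"
  unfolding poly_altdef by (intro Bochner_Integration.integrable_sum integrable_mult_right integrable_gauss_power)

text \<open>Read off from the closed forms of the moments: both sides vanish for even k, and for odd
  k the quotient of consecutive even moments is s k. At k = 0 the truncated k - 1 is masked by the
  factor 0.\<close>

lemma integral_gauss_power:
  assumes "0 < s"
  shows "(\<integral>x. x ^ Suc k \<partial>gauss s) = s * real k * (\<integral>x. x ^ (k - 1) \<partial>gauss s)"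
proof -
  have I: "(\<integral>x. x ^ i \<partial>gauss s) = (\<integral>x. normal_density 0 (sqrt s) x * (x - 0) ^ i \<partial>lborel)" for i
    unfolding gauss_def by (subst integral_density) auto
  have odd: "(\<integral>x. x ^ (2 * j + 1) \<partial>gauss s) = 0" for j
    unfolding I using integral_normal_moment_odd[of "sqrt s" 0 j] assms by simp
  have even: "(\<integral>x. x ^ (2 * j) \<partial>gauss s) = fact (2 * j) / ((2 / s) ^ j * fact j)" for j
    unfolding I using integral_normal_moment_even[of "sqrt s" 0 j] assms by simp
  show ?thesis
  proof (cases "even k")
    case True
    then obtain j where j: "k = 2 * j" by (elim evenE)
    show ?thesis
    proof (cases j)
      case 0
      then show ?thesis using odd[of 0] j by simp
    next
      case (Suc i)
      then have "k - 1 = 2 * i + 1" "Suc k = 2 * j + 1" using j by auto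
      then show ?thesis using odd by (simp only: mult_zero_right)
    qed
  next
    case False
    then obtain j where j: "k = 2 * j + 1" by (elim oddE)
    have "(\<integral>x. x ^ Suc k \<partial>gauss s) = fact (2 * Suc j) / ((2 / s) ^ Suc j * fact (Suc j))"
      using even[of "Suc j"] j by simp
    also have "\<dots> = s * real k * (fact (2 * j) / ((2 / s) ^ j * fact j))"
      using assms by (simp add: j divide_simps)
    finally show ?thesis using even[of j] j by simp
  qed
qed

lemma poly_fun_simps:
  "poly (p + q) = (\<lambda>x. poly p x + poly q x)" "poly (p - q) = (\<lambda>x. poly p x - poly q x)"
  "poly (smult c p) = (\<lambda>x. c * poly p x)" "poly 1 = (\<lambda>x. 1)"
  "poly (pCons 0 p) = (\<lambda>x. x * poly p x)" "poly (monom c k) = (\<lambda>x. c * x ^ k)"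
  for p q :: "real poly"
  by (simp_all add: fun_eq_iff poly_monom)

lemma pderiv_shift: "pderiv (q \<circ>\<^sub>p [:x, 1:]) = pderiv q \<circ>\<^sub>p [:x, 1 :: real:]"
  by (simp add: pderiv_pcompose pderiv_pCons)

context
  fixes s :: real
  assumes s: "0 < s"
begin

lemma gauss_mean_add: "gauss_mean s (p + q) = gauss_mean s p + gauss_mean s q"
  unfolding gauss_mean_def by (simp add: integrable_gauss_poly s poly_fun_simps)

lemma gauss_mean_diff: "gauss_mean s (p - q) = gauss_mean s p - gauss_mean s q"
  unfolding gauss_mean_def by (simp add: integrable_gauss_poly s poly_fun_simps)

lemma gauss_mean_smult: "gauss_mean s (smult c p) = c * gauss_mean s p"
  unfolding gauss_mean_def by (simp add: poly_fun_simps)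

lemma gauss_mean_1: "gauss_mean s 1 = 1"
  unfolding gauss_mean_def using prob_space.prob_space[OF prob_space_gauss[OF s]] by (simp add: poly_fun_simps)

text \<open>Gaussian integration by parts, obtained by linearity from the moment recursion.\<close>

lemma gauss_mean_stein: "gauss_mean s (pCons 0 q) = s * gauss_mean s (pderiv q)"
proof -
  have mon: "gauss_mean s (pCons 0 (monom c k)) = s * gauss_mean s (pderiv (monom c k))" for c k
  proof -
    have "gauss_mean s (pCons 0 (monom c k)) = c * (\<integral>x. x ^ Suc k \<partial>gauss s)"
      unfolding gauss_mean_def by (simp add: poly_fun_simps mult_ac flip: integral_mult_right_zero)
    also have "\<dots> = s * (real k * c * (\<integral>x. x ^ (k - 1) \<partial>gauss s))"
      by (subst integral_gauss_power[OF s]) simp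
    also have "real k * c * (\<integral>x. x ^ (k - 1) \<partial>gauss s) = gauss_mean s (pderiv (monom c k))"
      unfolding gauss_mean_def by (simp add: pderiv_monom poly_fun_simps)
    finally show ?thesis .
  qed
  have "gauss_mean s (pCons 0 (\<Sum>i\<le>m. monom (coeff q i) i)) = s * gauss_mean s (pderiv (\<Sum>i\<le>m. monom (coeff q i) i))" for m
  proof (induction m)
    case (Suc m)
    have pCons_add: "pCons 0 (p + r) = pCons 0 p + pCons 0 (r :: real poly)" for p r by simp
    show ?case using Suc mon by (simp add: pCons_add pderiv_add gauss_mean_add distrib_left del: add_pCons)
  qed (use mon in simp)
  then show ?thesis using poly_as_sum_of_monoms[of q] by metis
qed

text \<open>The operator defining \<open>herm\<close> is the adjoint of s d/dx: after Stein's
  identity and the product rule, the terms differentiating \<open>herm s a\<close> cancel.\<close>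

lemma gauss_mean_herm_mult:
  "gauss_mean s (herm s (Suc a) * q) = s * gauss_mean s (herm s a * pderiv q)"
proof -
  have "herm s (Suc a) * q = pCons 0 (herm s a * q) - smult s (pderiv (herm s a) * q)"
    by (simp add: left_diff_distrib)
  then show ?thesis
    by (simp add: gauss_mean_diff gauss_mean_stein gauss_mean_smult pderiv_mult gauss_mean_add algebra_simps)
qed

text \<open>The shifted recursion splits off x times the previous polynomial; the other two terms
  have mean 0 by Stein's identity.\<close>

lemma gauss_mean_herm_shift: "gauss_mean s (herm s b \<circ>\<^sub>p [:x, 1:]) = x ^ b"
proof (induction b)
  case (Suc b)
  have "herm s (Suc b) \<circ>\<^sub>p [:x, 1:] =
    smult x (herm s b \<circ>\<^sub>p [:x, 1:]) + pCons 0 (herm s b \<circ>\<^sub>p [:x, 1:]) - smult s (pderiv (herm s b \<circ>\<^sub>p [:x, 1:]))"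
    by (simp add: pcompose_diff pcompose_smult pcompose_pCons pderiv_shift)
  then show ?case
    using Suc by (simp only: gauss_mean_diff gauss_mean_add gauss_mean_smult gauss_mean_stein) simp
qed (simp add: gauss_mean_1 pcompose_1)

end

lemma pderiv_herm: "pderiv (herm s (Suc k)) = smult (real (Suc k)) (herm s k)"
proof (induction k)
  case (Suc k)
  have "pderiv (herm s (Suc (Suc k))) = herm s (Suc k) + (pCons 0 (pderiv (herm s (Suc k))) - smult s (pderiv (pderiv (herm s (Suc k)))))"
    by (subst herm.simps(2)) (simp only: pderiv_diff pderiv_smult pderiv_pCons add_diff_eq)
  also have "\<dots> = herm s (Suc k) + smult (real (Suc k)) (herm s (Suc k))"
    unfolding Suc.IH by (simp add: pderiv_smult smult_diff_right mult.commute)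
  also have "\<dots> = smult (real (Suc (Suc k))) (herm s (Suc k))"
    by (simp only: of_nat_Suc smult_add_left smult_1_left)
  finally show ?case .
qed (simp add: pderiv_pCons)

text \<open>Moves a derivatives onto the second factor, each lowering b by one, and finishes with
  the shift formula. For a > b the binomial is 0, so the truncated b - a does no harm.\<close>

lemma gauss_mean_herm_herm:
  assumes s: "0 < s"
  shows "gauss_mean s (herm s a * (herm s b \<circ>\<^sub>p [:x, 1:])) = s ^ a * (real (b choose a) * fact a) * x ^ (b - a)"
proof (induction a arbitrary: b)
  case 0
  then show ?case by (simp add: gauss_mean_herm_shift[OF s])
next
  case (Suc a)
  show ?case
  proof (cases b)
    case 0
    then show ?thesis by (simp only: 0 gauss_mean_herm_mult[OF s] herm.simps(1) pcompose_1 pderiv_1) (simp add: gauss_mean_def)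
  next
    case (Suc b')
    have "gauss_mean s (herm s (Suc a) * (herm s b \<circ>\<^sub>p [:x, 1:])) =
      s * (real (Suc b') * gauss_mean s (herm s a * (herm s b' \<circ>\<^sub>p [:x, 1:])))"
      unfolding gauss_mean_herm_mult[OF s] pderiv_shift Suc pderiv_herm
      by (simp add: pcompose_smult gauss_mean_smult[OF s] del: herm.simps of_nat_Suc)
    also have "\<dots> = s ^ Suc a * ((real (Suc b') * real (b' choose a)) * fact a) * x ^ (b' - a)"
      unfolding Suc.IH by simp
    also have "real (Suc b') * real (b' choose a) = real (Suc a) * real (Suc b' choose Suc a)"
      by (metis Suc_times_binomial of_nat_mult)
    finally show ?thesis by (simp add: Suc mult_ac del: binomial_Suc_Suc)
  qed
qed

lemma coeff_herm: "coeff (herm s k) k = 1 \<and> (\<forall>i>k. coeff (herm s k) i = 0)"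
proof (induction k)
  case (Suc k)
  then show ?case by (auto simp: coeff_pderiv coeff_pCons split: nat.splits)
qed (auto simp: coeff_1)

lemma herm_expansion:
  assumes "degree q \<le> m"
  shows "\<exists>c. q = (\<Sum>i\<le>m. smult (c i) (herm s i))"
  using assms
proof (induction m arbitrary: q)
  case 0
  then obtain a where "q = [:a:]" by (auto elim: degree_eq_zeroE)
  then show ?case by (intro exI[of _ "\<lambda>_. a"]) simp
next
  case (Suc m)
  define q' where "q' = q - smult (coeff q (Suc m)) (herm s (Suc m))"
  have "degree q' \<le> m"
  proof (rule degree_le, intro allI impI)
    fix i assume "m < i"
    then consider "i = Suc m" | "Suc m < i" by linarith
    then show "coeff q' i = 0"
    proof cases
      case 1
      then show ?thesis using coeff_herm[of s "Suc m"] by (simp add: q'_def del: herm.simps)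
    next
      case 2
      then have "coeff q i = 0" using Suc.prems by (intro coeff_eq_0) simp
      then show ?thesis using 2 coeff_herm[of s "Suc m"] by (simp add: q'_def del: herm.simps)
    qed
  qed
  then obtain c where c: "q' = (\<Sum>i\<le>m. smult (c i) (herm s i))" using Suc.IH by blast
  have "(\<Sum>i\<le>m. smult (c i) (herm s i)) = (\<Sum>i\<le>m. smult ((c(Suc m := coeff q (Suc m))) i) (herm s i))"
    by (intro sum.cong) auto
  then have "q = (\<Sum>i\<le>Suc m. smult ((c(Suc m := coeff q (Suc m))) i) (herm s i))"
    using c by (simp add: q'_def algebra_simps del: herm.simps fun_upd_apply) simp
  then show ?case by blast
qed

section \<open>Square-integrable functions and Cauchy-Schwarz\<close>

definition sq_integrable :: "'a measure \<Rightarrow> ('a \<Rightarrow> real) \<Rightarrow> bool" where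
  "sq_integrable M f \<longleftrightarrow> f \<in> borel_measurable M \<and> integrable M (\<lambda>x. (f x)\<^sup>2)"

lemma sq_integrable_mult:
  assumes "sq_integrable M f" "sq_integrable M g"
  shows "integrable M (\<lambda>x. f x * g x)"
proof (rule Bochner_Integration.integrable_bound)
  show "integrable M (\<lambda>x. (f x)\<^sup>2 + (g x)\<^sup>2)" using assms by (auto simp: sq_integrable_def)
  show "(\<lambda>x. f x * g x) \<in> borel_measurable M" using assms by (auto simp: sq_integrable_def)
  have "\<bar>a * b\<bar> \<le> a\<^sup>2 + b\<^sup>2" for a b :: real
  proof -
    have "2 * (\<bar>a\<bar> * \<bar>b\<bar>) \<le> a\<^sup>2 + b\<^sup>2" using sum_squares_bound[of "\<bar>a\<bar>" "\<bar>b\<bar>"] by simp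
    moreover have "0 \<le> \<bar>a\<bar> * \<bar>b\<bar>" by simp
    ultimately show ?thesis unfolding abs_mult by linarith
  qed
  then show "AE x in M. norm (f x * g x) \<le> norm ((f x)\<^sup>2 + (g x)\<^sup>2)" by simp
qed

lemma sq_integrable_cmult: "sq_integrable M f \<Longrightarrow> sq_integrable M (\<lambda>x. c * f x)"
  by (auto simp: sq_integrable_def power_mult_distrib)

lemma sq_integrable_add:
  assumes "sq_integrable M f" "sq_integrable M g"
  shows "sq_integrable M (\<lambda>x. f x + g x)"
  using assms sq_integrable_mult[OF assms]
  by (auto simp: sq_integrable_def power2_sum mult.assoc intro!: Bochner_Integration.integrable_add integrable_mult_right)

lemma sq_integrable_sum:
  "(\<And>i. i \<in> I \<Longrightarrow> sq_integrable M (f i)) \<Longrightarrow> sq_integrable M (\<lambda>x. \<Sum>i\<in>I. f i x)"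
proof (induction I rule: infinite_finite_induct)
  case (insert i I)
  then show ?case by (simp add: sq_integrable_add)
qed (simp_all add: sq_integrable_def)

lemma Cauchy_Schwarz_integral:
  assumes f: "sq_integrable M f" and g: "sq_integrable M g" and nz: "(\<integral>x. (f x)\<^sup>2 \<partial>M) \<noteq> 0"
  shows "(\<integral>x. f x * g x \<partial>M)\<^sup>2 \<le> (\<integral>x. (f x)\<^sup>2 \<partial>M) * (\<integral>x. (g x)\<^sup>2 \<partial>M)"
proof -
  define A B C where "A = (\<integral>x. (f x)\<^sup>2 \<partial>M)" and "B = (\<integral>x. (g x)\<^sup>2 \<partial>M)" and "C = (\<integral>x. f x * g x \<partial>M)"
  have "0 \<le> A" unfolding A_def by simp
  then have A: "0 < A" using nz by (simp add: A_def order_less_le)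
  have int: "integrable M (\<lambda>x. (f x)\<^sup>2)" "integrable M (\<lambda>x. (g x)\<^sup>2)" "integrable M (\<lambda>x. f x * g x)"
    using f g sq_integrable_mult by (auto simp: sq_integrable_def)
  \<comment> \<open>A times the residual of projecting g onto f; scaling by A avoids a
    division.\<close>
  have "0 \<le> (\<integral>x. (A * g x - C * f x)\<^sup>2 \<partial>M)" by simp
  also have "\<dots> = (\<integral>x. A\<^sup>2 * (g x)\<^sup>2 + C\<^sup>2 * (f x)\<^sup>2 - 2 * A * C * (f x * g x) \<partial>M)"
    by (simp add: power2_diff power_mult_distrib mult_ac)
  also have "\<dots> = A\<^sup>2 * B + C\<^sup>2 * A - 2 * A * C * C"
    using int by (simp add: A_def B_def C_def)
  also have "\<dots> = A * (A * B - C\<^sup>2)" by (simp add: power2_eq_square algebra_simps)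
  finally have "0 \<le> A * B - C\<^sup>2" using A by (simp add: zero_le_mult_iff)
  then show ?thesis by (simp add: A_def B_def C_def)
qed

text \<open>Noise variances. Since they are at least 1, they only shrink the norm of the dual witness.\<close>
definition nvar :: "nat \<times> nat \<Rightarrow> real" where
  "nvar p = (if fst p = snd p then 2 else 1)"

lemma nvar_pos [simp]: "0 < nvar p" and nvar_ge_1: "1 \<le> nvar p"
  by (simp_all add: nvar_def)

lemma Wdist_eq: "Wdist n = PiM (Idx n) (\<lambda>p. gauss (nvar p))"
  unfolding Wdist_def gauss_def nvar_def by (intro PiM_cong refl) simp

lemma product_prob_space_gauss: "product_prob_space (\<lambda>p. gauss (nvar p))"
  by (auto simp: product_prob_space_def product_prob_space_axioms_def product_sigma_finite_def
    intro!: prob_space_gauss prob_space_imp_sigma_finite)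

lemma prob_space_Wdist: "prob_space (Wdist n)"
  unfolding Wdist_eq by (intro prob_space_PiM prob_space_gauss) simp

lemma prob_space_Joint: "prob_space (Joint n rho)"
proof -
  interpret W: prob_space "Wdist n" by (rule prob_space_Wdist)
  interpret pair_prob_space "measure_pmf (Vdist n rho)" "Wdist n" ..
  show ?thesis unfolding Joint_def by (rule prob_space_axioms)
qed

text \<open>One shape for every basis function and for the target. It is closed under products and
  squares, so measurability, integrability and Fubini are settled once.\<close>

definition prod_term :: "nat \<Rightarrow> real \<Rightarrow> ((nat \<Rightarrow> bool) \<Rightarrow> real) \<Rightarrow> (nat \<times> nat \<Rightarrow> real poly) \<Rightarrow> (nat \<times> nat \<Rightarrow> real poly)
    \<Rightarrow> (nat \<Rightarrow> bool) \<times> (nat \<times> nat \<Rightarrow> real) \<Rightarrow> real" where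
  "prod_term n lam g a b \<omega> = g (fst \<omega>) *
     (\<Prod>p\<in>Idx n. poly (a p) (snd \<omega> p) * poly (b p) (Ymat lam (fst \<omega>) (snd \<omega>) p))"

lemma borel_measurable_poly [measurable]: "(\<lambda>x. poly q x) \<in> borel_measurable (borel :: real measure)"
  by (intro borel_measurable_continuous_onI continuous_intros)

lemma prod_term_measurable: "prod_term n lam g a b \<in> borel_measurable (Joint n rho)"
proof -
  have comp: "(\<lambda>\<omega>. h (fst \<omega>)) \<in> borel_measurable (Joint n rho)" for h :: "(nat \<Rightarrow> bool) \<Rightarrow> real"
    unfolding Joint_def by (rule measurable_compose[OF measurable_fst]) simp
  have W: "(\<lambda>\<omega>. snd \<omega> p) \<in> borel_measurable (Joint n rho)" if "p \<in> Idx n" for p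
  proof -
    have "(\<lambda>w. w p) \<in> measurable (Wdist n) (gauss (nvar p))"
      unfolding Wdist_eq by (rule measurable_component_singleton[OF that])
    then have "(\<lambda>w. w p) \<in> borel_measurable (Wdist n)"
      using measurable_cong_sets[OF refl sets_gauss] by blast
    then show ?thesis unfolding Joint_def by (rule measurable_compose[OF measurable_snd])
  qed
  have Y: "(\<lambda>\<omega>. Ymat lam (fst \<omega>) (snd \<omega>) p) \<in> borel_measurable (Joint n rho)" if "p \<in> Idx n" for p
    unfolding Ymat_def using comp[of "\<lambda>v. lam * of_bool (v (fst p) \<and> v (snd p))"] W[OF that] by simp
  show ?thesis unfolding prod_term_def
    by (intro borel_measurable_times borel_measurable_prod comp
      measurable_compose[OF W borel_measurable_poly] measurable_compose[OF Y borel_measurable_poly])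
qed

text \<open>Given v, Y is a shift of W entry by entry, so each factor becomes a polynomial in one
  Gaussian variable and the noise integral splits; v has finite support.\<close>

lemma integral_prod_term:
  "integrable (Joint n rho) (prod_term n lam g a b)"
  "(\<integral>\<omega>. prod_term n lam g a b \<omega> \<partial>Joint n rho) = measure_pmf.expectation (Vdist n rho)
     (\<lambda>v. g v * (\<Prod>p\<in>Idx n. gauss_mean (nvar p) (a p * (b p \<circ>\<^sub>p [:lam * of_bool (v (fst p) \<and> v (snd p)), 1:]))))"
proof -
  interpret W: prob_space "Wdist n" by (rule prob_space_Wdist)
  interpret P: pair_sigma_finite "measure_pmf (Vdist n rho)" "Wdist n" ..
  interpret G: product_prob_space "\<lambda>p. gauss (nvar p)" by (rule product_prob_space_gauss)
  let ?q = "\<lambda>v p. a p * (b p \<circ>\<^sub>p [:lam * of_bool (v (fst p) \<and> v (snd p)), 1:])"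
  have eq: "prod_term n lam g a b (v, w) = g v * (\<Prod>p\<in>Idx n. poly (?q v p) (w p))" for v w
    by (simp add: prod_term_def Ymat_def poly_pcompose)
  have int: "integrable (Wdist n) (\<lambda>w. prod_term n lam g a b (v, w))" for v
    unfolding eq Wdist_eq
    by (intro integrable_mult_right G.product_integrable_prod integrable_gauss_poly) auto
  have val: "(\<integral>w. prod_term n lam g a b (v, w) \<partial>Wdist n) = g v * (\<Prod>p\<in>Idx n. gauss_mean (nvar p) (?q v p))" for v
    unfolding eq Wdist_eq gauss_mean_def
    by (subst integral_mult_right_zero, subst G.product_integral_prod) (auto intro!: integrable_gauss_poly)
  show I: "integrable (Joint n rho) (prod_term n lam g a b)"
    unfolding Joint_def
  proof (rule P.Fubini_integrable)
    show "prod_term n lam g a b \<in> borel_measurable (measure_pmf (Vdist n rho) \<Otimes>\<^sub>M Wdist n)"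
      using prod_term_measurable unfolding Joint_def .
  qed (auto intro: integrable_measure_pmf_finite int)
  show "(\<integral>\<omega>. prod_term n lam g a b \<omega> \<partial>Joint n rho) = measure_pmf.expectation (Vdist n rho)
     (\<lambda>v. g v * (\<Prod>p\<in>Idx n. gauss_mean (nvar p) (?q v p)))"
    using P.integral_fst'[of "prod_term n lam g a b"] I unfolding Joint_def val by simp
qed

lemma sq_integrable_prod_term: "sq_integrable (Joint n rho) (prod_term n lam g a b)"
proof -
  have "(\<lambda>\<omega>. (prod_term n lam g a b \<omega>)\<^sup>2) = prod_term n lam (\<lambda>v. (g v)\<^sup>2) (\<lambda>p. (a p)\<^sup>2) (\<lambda>p. (b p)\<^sup>2)"
    by (simp add: fun_eq_iff prod_term_def power_mult_distrib prod_power_distrib)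
  then show ?thesis
    unfolding sq_integrable_def using prod_term_measurable integral_prod_term(1) by simp
qed

lemma prod_term_mult:
  "prod_term n lam g a b \<omega> * prod_term n lam g' a' b' \<omega> =
   prod_term n lam (\<lambda>v. g v * g' v) (\<lambda>p. a p * a' p) (\<lambda>p. b p * b' p) \<omega>"
  by (simp add: prod_term_def prod.distrib mult_ac)

definition herm_W :: "nat \<Rightarrow> real \<Rightarrow> (nat \<times> nat \<Rightarrow> nat) \<Rightarrow> (nat \<Rightarrow> bool) \<times> (nat \<times> nat \<Rightarrow> real) \<Rightarrow> real" where
  "herm_W n lam \<alpha> = prod_term n lam (\<lambda>v. 1) (\<lambda>p. herm (nvar p) (\<alpha> p)) (\<lambda>p. 1)"

definition herm_Y :: "nat \<Rightarrow> real \<Rightarrow> (nat \<times> nat \<Rightarrow> nat) \<Rightarrow> (nat \<Rightarrow> bool) \<times> (nat \<times> nat \<Rightarrow> real) \<Rightarrow> real" where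
  "herm_Y n lam \<alpha> = prod_term n lam (\<lambda>v. 1) (\<lambda>p. 1) (\<lambda>p. herm (nvar p) (\<alpha> p))"

definition mvar :: "nat \<Rightarrow> (nat \<times> nat \<Rightarrow> nat) \<Rightarrow> real" where
  "mvar n \<alpha> = (\<Prod>p\<in>Idx n. nvar p ^ \<alpha> p)"

lemma mvar_ge_1: "1 \<le> mvar n \<alpha>"
  unfolding mvar_def by (intro prod_ge_1 one_le_power nvar_ge_1)

text \<open>The triangular system: binomial and moment are those of the recursion, and the prefactor
  depends only on \<alpha>.\<close>

lemma integral_herm_W_herm_Y:
  "(\<integral>\<omega>. herm_W n lam \<alpha> \<omega> * herm_Y n lam \<beta> \<omega> \<partial>Joint n rho) =
    mvar n \<alpha> * mfact n \<alpha> * mbinom n \<beta> \<alpha> * EXmon n rho lam (\<lambda>p. \<beta> p - \<alpha> p)"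
proof -
  have "(\<integral>\<omega>. herm_W n lam \<alpha> \<omega> * herm_Y n lam \<beta> \<omega> \<partial>Joint n rho) =
    measure_pmf.expectation (Vdist n rho) (\<lambda>v. mvar n \<alpha> * mfact n \<alpha> * mbinom n \<beta> \<alpha> * Xmon n lam v (\<lambda>p. \<beta> p - \<alpha> p))"
    unfolding herm_W_def herm_Y_def prod_term_mult integral_prod_term(2)
    by (simp add: gauss_mean_herm_herm prod.distrib mvar_def mfact_def mbinom_def Xmon_def mult_ac)
  then show ?thesis by (simp add: EXmon_def)
qed

lemma integral_target_herm_Y:
  "(\<integral>\<omega>. of_bool (fst \<omega> 0) * herm_Y n lam \<beta> \<omega> \<partial>Joint n rho) = Ev1Xmon n rho lam \<beta>"
proof -
  have "of_bool (fst \<omega> 0) * herm_Y n lam \<beta> \<omega> =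
     prod_term n lam (\<lambda>v. of_bool (v 0)) (\<lambda>p. 1) (\<lambda>p. herm (nvar p) (\<beta> p)) \<omega>" for \<omega>
    by (simp add: herm_Y_def prod_term_def)
  then show ?thesis
    by (simp add: integral_prod_term(2) gauss_mean_herm_shift Ev1Xmon_def Xmon_def)
qed

text \<open>The shift formula at x = 0. At an entry where \<alpha> and \<beta> differ, either the
  power of 0 or the binomial vanishes.\<close>

lemma integral_herm_W_herm_W:
  assumes "\<alpha> \<in> msupp n" "\<beta> \<in> msupp n"
  shows "(\<integral>\<omega>. herm_W n lam \<alpha> \<omega> * herm_W n lam \<beta> \<omega> \<partial>Joint n rho) = (if \<alpha> = \<beta> then mvar n \<alpha> * mfact n \<alpha> else 0)"
proof -
  have shift0: "q \<circ>\<^sub>p [:0, 1:] = (q :: real poly)" for q by (rule pcompose_idR)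
  have mean: "gauss_mean (nvar p) (herm (nvar p) a * herm (nvar p) b) =
      nvar p ^ a * (real (b choose a) * fact a) * 0 ^ (b - a)" for p a b
    using gauss_mean_herm_herm[of "nvar p" a b 0] by (simp add: shift0)
  have "(\<integral>\<omega>. herm_W n lam \<alpha> \<omega> * herm_W n lam \<beta> \<omega> \<partial>Joint n rho) =
    (\<Prod>p\<in>Idx n. nvar p ^ \<alpha> p * (real (\<beta> p choose \<alpha> p) * fact (\<alpha> p)) * 0 ^ (\<beta> p - \<alpha> p))"
    unfolding herm_W_def prod_term_mult integral_prod_term(2)
    by (simp add: mean pcompose_1)
  also have "\<dots> = (if \<alpha> = \<beta> then mvar n \<alpha> * mfact n \<alpha> else 0)"
  proof (cases "\<alpha> = \<beta>")
    case True
    then show ?thesis by (simp add: mvar_def mfact_def prod.distrib)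
  next
    case False
    then obtain p where p: "\<alpha> p \<noteq> \<beta> p" by blast
    then have "p \<in> Idx n" using assms unfolding msupp_def mem_Collect_eq by metis
    moreover have "nvar p ^ \<alpha> p * (real (\<beta> p choose \<alpha> p) * fact (\<alpha> p)) * 0 ^ (\<beta> p - \<alpha> p) = 0"
      using p by (cases "\<alpha> p < \<beta> p") auto
    ultimately show ?thesis using False by (auto intro!: prod_zero)
  qed
  finally show ?thesis .
qed

text \<open>The dual witness: a function of the noise alone that has the same correlation with every
  low-degree polynomial in \<open>Y\<close> as the target.\<close>
definition witness :: "nat \<Rightarrow> real \<Rightarrow> real \<Rightarrow> nat \<Rightarrow> (nat \<Rightarrow> bool) \<times> (nat \<times> nat \<Rightarrow> real) \<Rightarrow> real" where
  "witness n rho lam D \<omega> = (\<Sum>\<alpha>\<in>Mons n D. kappa n rho lam \<alpha> / (mvar n \<alpha> * mfact n \<alpha>) * herm_W n lam \<alpha> \<omega>)"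

lemma sq_integrable_herm_W: "sq_integrable (Joint n rho) (herm_W n lam \<alpha>)"
  and sq_integrable_herm_Y: "sq_integrable (Joint n rho) (herm_Y n lam \<alpha>)"
  unfolding herm_W_def herm_Y_def by (rule sq_integrable_prod_term)+

lemma sq_integrable_witness: "sq_integrable (Joint n rho) (witness n rho lam D)"
  unfolding witness_def by (intro sq_integrable_sum sq_integrable_cmult sq_integrable_herm_W)

lemma sq_integrable_target: "sq_integrable (Joint n rho) (\<lambda>\<omega>. of_bool (fst \<omega> 0))"
proof -
  have "(\<lambda>\<omega>. of_bool (fst \<omega> 0)) = prod_term n 0 (\<lambda>v. of_bool (v 0)) (\<lambda>p. 1) (\<lambda>p. 1)"
    by (simp add: fun_eq_iff prod_term_def)
  then show ?thesis by (simp only: sq_integrable_prod_term)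
qed

lemma witness_norm:
  "(\<integral>\<omega>. (witness n rho lam D \<omega>)\<^sup>2 \<partial>Joint n rho) \<le> (\<Sum>\<alpha>\<in>Mons n D. (kappa n rho lam \<alpha>)\<^sup>2 / mfact n \<alpha>)"
proof -
  define c where "c = (\<lambda>\<alpha>. kappa n rho lam \<alpha> / (mvar n \<alpha> * mfact n \<alpha>))"
  have int: "integrable (Joint n rho) (\<lambda>\<omega>. herm_W n lam \<alpha> \<omega> * herm_W n lam \<beta> \<omega>)" for \<alpha> \<beta>
    by (intro sq_integrable_mult sq_integrable_herm_W)
  have "(\<integral>\<omega>. (witness n rho lam D \<omega>)\<^sup>2 \<partial>Joint n rho) =
    (\<integral>\<omega>. (\<Sum>\<alpha>\<in>Mons n D. \<Sum>\<beta>\<in>Mons n D. (c \<alpha> * c \<beta>) * (herm_W n lam \<alpha> \<omega> * herm_W n lam \<beta> \<omega>)) \<partial>Joint n rho)"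
    by (simp add: witness_def power2_eq_square sum_product c_def mult_ac)
  also have "\<dots> = (\<Sum>\<alpha>\<in>Mons n D. \<Sum>\<beta>\<in>Mons n D. (c \<alpha> * c \<beta>) * (\<integral>\<omega>. herm_W n lam \<alpha> \<omega> * herm_W n lam \<beta> \<omega> \<partial>Joint n rho))"
    using int by (simp add: Bochner_Integration.integral_sum)
  also have "\<dots> = (\<Sum>\<alpha>\<in>Mons n D. \<Sum>\<beta>\<in>Mons n D. if \<alpha> = \<beta> then (c \<alpha>)\<^sup>2 * (mvar n \<alpha> * mfact n \<alpha>) else 0)"
    by (intro sum.cong refl) (auto simp: integral_herm_W_herm_W Mons_eq power2_eq_square)
  also have "\<dots> = (\<Sum>\<alpha>\<in>Mons n D. (c \<alpha>)\<^sup>2 * (mvar n \<alpha> * mfact n \<alpha>))"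
    by (simp add: sum.delta)
  also have "\<dots> \<le> (\<Sum>\<alpha>\<in>Mons n D. (kappa n rho lam \<alpha>)\<^sup>2 / mfact n \<alpha>)"
  proof (rule sum_mono)
    fix \<alpha>
    have m: "0 < mvar n \<alpha>" using mvar_ge_1[of n \<alpha>] by linarith
    have "(c \<alpha>)\<^sup>2 * (mvar n \<alpha> * mfact n \<alpha>) = (kappa n rho lam \<alpha>)\<^sup>2 / (mvar n \<alpha> * mfact n \<alpha>)"
      using m mfact_pos[of n \<alpha>] by (simp add: c_def power_divide power2_eq_square)
    also have "\<dots> \<le> (kappa n rho lam \<alpha>)\<^sup>2 / (1 * mfact n \<alpha>)"
      using mvar_ge_1[of n \<alpha>] mfact_pos[of n \<alpha>] by (intro divide_left_mono mult_right_mono mult_pos_pos) auto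
    finally show "(c \<alpha>)\<^sup>2 * (mvar n \<alpha> * mfact n \<alpha>) \<le> (kappa n rho lam \<alpha>)\<^sup>2 / mfact n \<alpha>" by simp
  qed
  finally show ?thesis .
qed

text \<open>The denominators in \<open>witness\<close> cancel the prefactors, the binomials confine
  the sum to \<open>below \<beta>\<close>, and what remains is the convolution identity.\<close>

lemma witness_herm_Y:
  assumes "\<beta> \<in> Mons n D"
  shows "(\<integral>\<omega>. witness n rho lam D \<omega> * herm_Y n lam \<beta> \<omega> \<partial>Joint n rho) =
    (\<integral>\<omega>. of_bool (fst \<omega> 0) * herm_Y n lam \<beta> \<omega> \<partial>Joint n rho)"
proof -
  have \<beta>: "\<beta> \<in> msupp n" "mdeg n \<beta> \<le> D" using assms by (auto simp: Mons_eq)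
  have int: "integrable (Joint n rho) (\<lambda>\<omega>. herm_W n lam \<alpha> \<omega> * herm_Y n lam \<beta> \<omega>)" for \<alpha>
    by (intro sq_integrable_mult sq_integrable_herm_W sq_integrable_herm_Y)
  have "(\<integral>\<omega>. witness n rho lam D \<omega> * herm_Y n lam \<beta> \<omega> \<partial>Joint n rho) =
    (\<integral>\<omega>. (\<Sum>\<alpha>\<in>Mons n D. kappa n rho lam \<alpha> / (mvar n \<alpha> * mfact n \<alpha>) * (herm_W n lam \<alpha> \<omega> * herm_Y n lam \<beta> \<omega>)) \<partial>Joint n rho)"
    by (simp add: witness_def sum_distrib_right mult.assoc)
  also have "\<dots> = (\<Sum>\<alpha>\<in>Mons n D. kappa n rho lam \<alpha> / (mvar n \<alpha> * mfact n \<alpha>) *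
      (\<integral>\<omega>. herm_W n lam \<alpha> \<omega> * herm_Y n lam \<beta> \<omega> \<partial>Joint n rho))"
    using int by (subst Bochner_Integration.integral_sum) auto
  also have "\<dots> = (\<Sum>\<alpha>\<in>Mons n D. kappa n rho lam \<alpha> * mbinom n \<beta> \<alpha> * EXmon n rho lam (\<lambda>p. \<beta> p - \<alpha> p))"
  proof (intro sum.cong refl)
    fix \<alpha>
    have "mvar n \<alpha> \<noteq> 0" "mfact n \<alpha> \<noteq> 0" using mvar_ge_1[of n \<alpha>] mfact_pos[of n \<alpha>] by auto
    then show "kappa n rho lam \<alpha> / (mvar n \<alpha> * mfact n \<alpha>) * (\<integral>\<omega>. herm_W n lam \<alpha> \<omega> * herm_Y n lam \<beta> \<omega> \<partial>Joint n rho)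
      = kappa n rho lam \<alpha> * mbinom n \<beta> \<alpha> * EXmon n rho lam (\<lambda>p. \<beta> p - \<alpha> p)"
      by (simp add: integral_herm_W_herm_Y)
  qed
  also have "\<dots> = (\<Sum>\<alpha>\<in>below \<beta>. kappa n rho lam \<alpha> * mbinom n \<beta> \<alpha> * EXmon n rho lam (\<lambda>p. \<beta> p - \<alpha> p))"
  proof (rule sum.mono_neutral_right)
    show "below \<beta> \<subseteq> Mons n D" by (rule below_subset_Mons[OF assms])
    show "\<forall>\<alpha>\<in>Mons n D - below \<beta>. kappa n rho lam \<alpha> * mbinom n \<beta> \<alpha> * EXmon n rho lam (\<lambda>p. \<beta> p - \<alpha> p) = 0"
    proof
      fix \<alpha> assume \<alpha>: "\<alpha> \<in> Mons n D - below \<beta>"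
      then obtain p where p: "\<beta> p < \<alpha> p" by (auto simp: below_def not_le)
      then have "\<alpha> p \<noteq> 0" by simp
      moreover have "\<alpha> \<in> msupp n" using \<alpha> by (simp add: Mons_eq)
      ultimately have "p \<in> Idx n" unfolding msupp_def mem_Collect_eq by metis
      then have "mbinom n \<beta> \<alpha> = 0" unfolding mbinom_def using p by (intro prod_zero) auto
      then show "kappa n rho lam \<alpha> * mbinom n \<beta> \<alpha> * EXmon n rho lam (\<lambda>p. \<beta> p - \<alpha> p) = 0" by simp
    qed
  qed simp
  also have "\<dots> = Ev1Xmon n rho lam \<beta>" by (rule sum_kappa_below[OF \<beta>(1)])
  finally show ?thesis by (simp add: integral_target_herm_Y)
qed

text \<open>Expands each power in the Hermite basis for the variance of its entry. Multiplying out
  stays below \<beta>, so the degree bound survives.\<close>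

lemma monomial_herm_Y:
  assumes "\<beta> \<in> msupp n"
  shows "\<exists>c. \<forall>\<omega>. (\<Prod>p\<in>Idx n. Ymat lam (fst \<omega>) (snd \<omega>) p ^ \<beta> p) = (\<Sum>\<gamma>\<in>below \<beta>. c \<gamma> * herm_Y n lam \<gamma> \<omega>)"
proof -
  have "\<exists>c. monom 1 (\<beta> p) = (\<Sum>i\<le>\<beta> p. smult (c i) (herm (nvar p) i))" for p
    by (intro herm_expansion degree_monom_le)
  then obtain c where c: "\<And>p. monom 1 (\<beta> p) = (\<Sum>i\<le>\<beta> p. smult (c p i) (herm (nvar p) i))" by metis
  have pow: "y ^ \<beta> p = (\<Sum>i\<le>\<beta> p. c p i * poly (herm (nvar p) i) y)" for p y
    using arg_cong[OF c[of p], of "\<lambda>q. poly q y"] by (simp add: poly_monom poly_sum)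
  show ?thesis
  proof (intro exI[of _ "\<lambda>\<gamma>. \<Prod>p\<in>Idx n. c p (\<gamma> p)"] allI)
    fix \<omega> :: "(nat \<Rightarrow> bool) \<times> (nat \<times> nat \<Rightarrow> real)"
    let ?Y = "Ymat lam (fst \<omega>) (snd \<omega>)"
    have "(\<Prod>p\<in>Idx n. ?Y p ^ \<beta> p) = (\<Prod>p\<in>Idx n. \<Sum>i\<in>{..\<beta> p}. c p i * poly (herm (nvar p) i) (?Y p))"
      by (intro prod.cong refl pow)
    also have "\<dots> = (\<Sum>\<gamma>\<in>below \<beta>. \<Prod>p\<in>Idx n. c p (\<gamma> p) * poly (herm (nvar p) (\<gamma> p)) (?Y p))"
      unfolding below_eq_PiE_dflt[OF assms] by (rule prod_sum_PiE_dflt) auto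
    also have "\<dots> = (\<Sum>\<gamma>\<in>below \<beta>. (\<Prod>p\<in>Idx n. c p (\<gamma> p)) * herm_Y n lam \<gamma> \<omega>)"
      by (simp add: prod.distrib herm_Y_def prod_term_def)
    finally show "(\<Prod>p\<in>Idx n. ?Y p ^ \<beta> p) = (\<Sum>\<gamma>\<in>below \<beta>. (\<Prod>p\<in>Idx n. c p (\<gamma> p)) * herm_Y n lam \<gamma> \<omega>)" .
  qed
qed

lemma polyval_herm_Y:
  "\<exists>c'. \<forall>\<omega>. polyval n D c (Ymat lam (fst \<omega>) (snd \<omega>)) = (\<Sum>\<gamma>\<in>Mons n D. c' \<gamma> * herm_Y n lam \<gamma> \<omega>)"
proof -
  have "\<forall>\<beta>\<in>Mons n D. \<exists>b. \<forall>\<omega>. (\<Prod>p\<in>Idx n. Ymat lam (fst \<omega>) (snd \<omega>) p ^ \<beta> p) = (\<Sum>\<gamma>\<in>below \<beta>. b \<gamma> * herm_Y n lam \<gamma> \<omega>)"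
    using monomial_herm_Y by (auto simp: Mons_eq)
  then obtain b where b: "\<And>\<beta> \<omega>. \<beta> \<in> Mons n D \<Longrightarrow>
      (\<Prod>p\<in>Idx n. Ymat lam (fst \<omega>) (snd \<omega>) p ^ \<beta> p) = (\<Sum>\<gamma>\<in>below \<beta>. b \<beta> \<gamma> * herm_Y n lam \<gamma> \<omega>)"
    by metis
  define c' where "c' = (\<lambda>\<gamma>. \<Sum>\<beta>\<in>Mons n D. if \<gamma> \<in> below \<beta> then c \<beta> * b \<beta> \<gamma> else 0)"
  have "polyval n D c (Ymat lam (fst \<omega>) (snd \<omega>)) = (\<Sum>\<gamma>\<in>Mons n D. c' \<gamma> * herm_Y n lam \<gamma> \<omega>)" for \<omega>
  proof -
    have "polyval n D c (Ymat lam (fst \<omega>) (snd \<omega>)) =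
      (\<Sum>\<beta>\<in>Mons n D. \<Sum>\<gamma>\<in>below \<beta>. c \<beta> * b \<beta> \<gamma> * herm_Y n lam \<gamma> \<omega>)"
      unfolding polyval_def by (intro sum.cong refl) (simp add: b sum_distrib_left mult.assoc)
    also have "\<dots> = (\<Sum>\<beta>\<in>Mons n D. \<Sum>\<gamma>\<in>Mons n D. (if \<gamma> \<in> below \<beta> then c \<beta> * b \<beta> \<gamma> else 0) * herm_Y n lam \<gamma> \<omega>)"
      using below_subset_Mons by (intro sum.cong refl sum.mono_neutral_cong_left) auto
    also have "\<dots> = (\<Sum>\<gamma>\<in>Mons n D. c' \<gamma> * herm_Y n lam \<gamma> \<omega>)"
      unfolding c'_def by (subst sum.swap) (simp add: sum_distrib_right)
    finally show ?thesis .
  qed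
  then show ?thesis by blast
qed

lemma sq_integrable_polyval: "sq_integrable (Joint n rho) (\<lambda>\<omega>. polyval n D c (Ymat lam (fst \<omega>) (snd \<omega>)))"
  and witness_polyval:
  "(\<integral>\<omega>. polyval n D c (Ymat lam (fst \<omega>) (snd \<omega>)) * witness n rho lam D \<omega> \<partial>Joint n rho) =
   (\<integral>\<omega>. polyval n D c (Ymat lam (fst \<omega>) (snd \<omega>)) * of_bool (fst \<omega> 0) \<partial>Joint n rho)"
proof -
  obtain c' where c': "\<And>\<omega>. polyval n D c (Ymat lam (fst \<omega>) (snd \<omega>)) = (\<Sum>\<gamma>\<in>Mons n D. c' \<gamma> * herm_Y n lam \<gamma> \<omega>)"
    using polyval_herm_Y by blast
  show "sq_integrable (Joint n rho) (\<lambda>\<omega>. polyval n D c (Ymat lam (fst \<omega>) (snd \<omega>)))"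
    unfolding c' by (intro sq_integrable_sum sq_integrable_cmult sq_integrable_herm_Y)
  have lin: "(\<integral>\<omega>. polyval n D c (Ymat lam (fst \<omega>) (snd \<omega>)) * h \<omega> \<partial>Joint n rho) =
     (\<Sum>\<gamma>\<in>Mons n D. c' \<gamma> * (\<integral>\<omega>. h \<omega> * herm_Y n lam \<gamma> \<omega> \<partial>Joint n rho))"
    if "sq_integrable (Joint n rho) h" for h
  proof -
    have int: "integrable (Joint n rho) (\<lambda>\<omega>. h \<omega> * herm_Y n lam \<gamma> \<omega>)" for \<gamma>
      by (intro sq_integrable_mult that sq_integrable_herm_Y)
    have "(\<integral>\<omega>. polyval n D c (Ymat lam (fst \<omega>) (snd \<omega>)) * h \<omega> \<partial>Joint n rho) =
      (\<integral>\<omega>. (\<Sum>\<gamma>\<in>Mons n D. c' \<gamma> * (h \<omega> * herm_Y n lam \<gamma> \<omega>)) \<partial>Joint n rho)"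
      unfolding c' sum_distrib_right by (simp add: mult_ac)
    then show ?thesis using int by (simp add: Bochner_Integration.integral_sum)
  qed
  show "(\<integral>\<omega>. polyval n D c (Ymat lam (fst \<omega>) (snd \<omega>)) * witness n rho lam D \<omega> \<partial>Joint n rho) =
   (\<integral>\<omega>. polyval n D c (Ymat lam (fst \<omega>) (snd \<omega>)) * of_bool (fst \<omega> 0) \<partial>Joint n rho)"
    unfolding lin[OF sq_integrable_witness] lin[OF sq_integrable_target]
    by (intro sum.cong refl) (simp add: witness_herm_Y)
qed

lemma Corr_square_le: "(Corr n rho lam D)\<^sup>2 \<le> (\<Sum>\<alpha>\<in>Mons n D. (kappa n rho lam \<alpha>)\<^sup>2 / mfact n \<alpha>)"
proof -
  define B where "B = (\<Sum>\<alpha>\<in>Mons n D. (kappa n rho lam \<alpha>)\<^sup>2 / mfact n \<alpha>)"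
  define A where "A = (\<lambda>c. \<integral>\<omega>. (polyval n D c (Ymat lam (fst \<omega>) (snd \<omega>)))\<^sup>2 \<partial>Joint n rho)"
  define C where "C = (\<lambda>c. \<integral>\<omega>. polyval n D c (Ymat lam (fst \<omega>) (snd \<omega>)) * of_bool (fst \<omega> 0) \<partial>Joint n rho)"
  have B0: "0 \<le> B" unfolding B_def using mfact_pos by (intro sum_nonneg divide_nonneg_pos) auto
  have bound: "\<bar>C c / sqrt (A c)\<bar> \<le> sqrt B" if nz: "A c \<noteq> 0" for c
  proof -
    have A0: "0 \<le> A c" unfolding A_def by simp
    have "(C c)\<^sup>2 \<le> A c * (\<integral>\<omega>. (witness n rho lam D \<omega>)\<^sup>2 \<partial>Joint n rho)"
      unfolding C_def A_def witness_polyval[symmetric]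
      by (intro Cauchy_Schwarz_integral sq_integrable_polyval sq_integrable_witness) (use nz in \<open>simp add: A_def\<close>)
    also have "\<dots> \<le> A c * B" unfolding B_def by (intro mult_left_mono witness_norm A0)
    finally have "sqrt ((C c)\<^sup>2) \<le> sqrt (A c * B)" by (rule real_sqrt_le_mono)
    then have "\<bar>C c\<bar> \<le> sqrt (A c) * sqrt B" by (simp add: real_sqrt_mult)
    then show ?thesis using A0 nz by (simp add: field_simps)
  qed
  \<comment> \<open>The constant polynomial 1 is admissible, so the supremum is over a nonempty
    set.\<close>
  have A1: "A (\<lambda>\<alpha>. of_bool (\<alpha> = (\<lambda>p. 0))) \<noteq> 0"
  proof -
    have "polyval n D (\<lambda>\<alpha>. of_bool (\<alpha> = (\<lambda>p. 0))) Y = 1" for Y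
    proof -
      have "polyval n D (\<lambda>\<alpha>. of_bool (\<alpha> = (\<lambda>p. 0))) Y =
        (\<Sum>\<alpha>\<in>Mons n D. if \<alpha> = (\<lambda>p. 0) then 1 else 0)"
        unfolding polyval_def by (intro sum.cong refl) auto
      moreover have "(\<lambda>p. 0) \<in> Mons n D" by (simp add: Mons_def)
      ultimately show ?thesis by simp
    qed
    then show ?thesis
      unfolding A_def using prob_space.prob_space[OF prob_space_Joint] by simp
  qed
  let ?S = "(\<lambda>c. C c / sqrt (A c)) ` {c. A c \<noteq> 0}"
  have Corr: "Corr n rho lam D = Sup ?S" unfolding Corr_def A_def C_def ..
  \<comment> \<open>Both sides are bounded because \<open>Corr\<close> is squared: an upper bound on
    the supremum alone would not control its square.\<close>
  have upper: "x \<le> sqrt B" and lower: "- sqrt B \<le> x" if x: "x \<in> ?S" for x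
  proof -
    obtain c where "A c \<noteq> 0" "x = C c / sqrt (A c)" using x by blast
    then have "\<bar>x\<bar> \<le> sqrt B" using bound by simp
    then show "x \<le> sqrt B" "- sqrt B \<le> x" by linarith+
  qed
  obtain x where x: "x \<in> ?S" using A1 by blast
  have "Sup ?S \<le> sqrt B" using x upper by (intro cSup_least) auto
  moreover have "- sqrt B \<le> Sup ?S"
    using lower[OF x] cSup_upper[OF x] upper by (meson bdd_above.I order_trans)
  ultimately have "\<bar>Corr n rho lam D\<bar> \<le> sqrt B" unfolding Corr by linarith
  then have "\<bar>Corr n rho lam D\<bar>\<^sup>2 \<le> (sqrt B)\<^sup>2" by (intro power_mono) auto
  then show ?thesis using B0 by (simp add: B_def)
qed

section \<open>The low-degree correlation\<close>

lemma two_power_mult_le_half: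
  fixes rho :: real
  assumes "0 < rho" "real D \<le> log 2 (1 / rho) - 1"
  shows "2 ^ D * rho \<le> 1 / 2"
proof -
  have "real (Suc D) \<le> log 2 (1 / rho)" using assms(2) by simp
  then have "2 powr real (Suc D) \<le> 1 / rho" using assms(1) by (subst (asm) le_log_iff) auto
  then have "2 ^ Suc D \<le> 1 / rho" by (simp only: powr_realpow zero_less_numeral)
  then show ?thesis using assms(1) by (simp add: field_simps)
qed

theorem mainTheorem18:
  fixes n :: nat and rho lam :: real
  assumes "n \<ge> 1" and "0 < rho" and "rho < 1" and "lam \<ge> 0"
  shows "(\<forall>(r::real) (D::nat). 0 < r \<and> r < 1 \<and> lam \<le> sqrt (r / (exp 1 * rho\<^sup>2 * real n))
            \<and> 1 \<le> D \<and> real D \<le> log 2 (1 / rho) - 1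
            \<and> real D \<le> sqrt (exp 1 / 3 * r * rho\<^sup>2 * real n)
          \<longrightarrow> (Corr n rho lam D)\<^sup>2 \<le> 2 * rho\<^sup>2 / (1 - r)\<^sup>2)
       \<and> (\<forall>D::nat. 1 \<le> D \<and> real D \<le> log 2 (1 / rho) - 1 \<and> D \<le> n - 1
          \<longrightarrow> (\<Sum>\<alpha>\<in>Mons n D. (kappa n rho lam \<alpha>)\<^sup>2 / mfact n \<alpha>)
              \<ge> rho\<^sup>2 / (4 * exp 1 * real D powr (3/2))
                 * (exp 1 * lam\<^sup>2 * rho\<^sup>2 * (real n - real D)) ^ D)"
proof (intro conjI allI impI)
  fix r :: real and D :: nat
  assume *: "0 < r \<and> r < 1 \<and> lam \<le> sqrt (r / (exp 1 * rho\<^sup>2 * real n))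
            \<and> 1 \<le> D \<and> real D \<le> log 2 (1 / rho) - 1
            \<and> real D \<le> sqrt (exp 1 / 3 * r * rho\<^sup>2 * real n)"
  have "lam\<^sup>2 \<le> (sqrt (r / (exp 1 * rho\<^sup>2 * real n)))\<^sup>2"
    using * assms(4) by (intro power_mono) auto
  then have lam: "lam\<^sup>2 \<le> r / (exp 1 * rho\<^sup>2 * real n)" using * by simp
  have "(real D)\<^sup>2 \<le> (sqrt (exp 1 / 3 * r * rho\<^sup>2 * real n))\<^sup>2"
    using * by (intro power_mono) auto
  then have D: "(real D)\<^sup>2 \<le> exp 1 / 3 * r * rho\<^sup>2 * real n" using * by simp
  have "2 ^ D * rho \<le> 1 / 2" using * assms(2) by (intro two_power_mult_le_half) auto
  then have "(\<Sum>\<alpha>\<in>Mons n D. (kappa n rho lam \<alpha>)\<^sup>2 / mfact n \<alpha>) \<le> 2 * rho\<^sup>2 / (1 - r)\<^sup>2"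
    using * assms lam D by (intro sum_kappa_upper) auto
  then show "(Corr n rho lam D)\<^sup>2 \<le> 2 * rho\<^sup>2 / (1 - r)\<^sup>2"
    using Corr_square_le[of n rho lam D] by linarith
next
  fix D :: nat
  assume *: "1 \<le> D \<and> real D \<le> log 2 (1 / rho) - 1 \<and> D \<le> n - 1"
  then have "2 ^ D * rho \<le> 1 / 2" using assms(2) by (intro two_power_mult_le_half) auto
  then show "rho\<^sup>2 / (4 * exp 1 * real D powr (3/2)) * (exp 1 * lam\<^sup>2 * rho\<^sup>2 * (real n - real D)) ^ D
      \<le> (\<Sum>\<alpha>\<in>Mons n D. (kappa n rho lam \<alpha>)\<^sup>2 / mfact n \<alpha>)"
    using * assms by (intro sum_kappa_lower) auto
qed

end
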